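(* Let $g : \mathbf{R}^n \to \mathbf{R}$ be a $C^\infty$ differentiable function. Then for any open interval $U \subseteq g(\mathbf{R}^n) \setminus (\Sigma_g \cup S_g)$, the restriction $g : g^{-1}(U) \to U$ is a $C^\infty$ trivial fibration.
   Context: For a smooth ($C^\infty$) function $g : \mathbf{R}^n \to \mathbf{R}$: - $\Sigma_g$ denotes the set of critical values of $g$, i.e. $\Sigma_g = \{ g(x) \mid x \in \mathbf{R}^n, \operatorname{grad} g(x) = 0 \}$. - $M(g) := \{ x \in \mathbf{R}^n \mid \exists \lambda \in \mathbf{R},\ \operatorname{grad} g(x) = \lambda x \}$. - $S_g$ is the set of all $c \in \mathbf{R}$ for which there exists a sequence $\{y^k\} \subseteq M(g)$ with $\lim_{k\to\infty} \|y^k\| = \infty$ and $\lim_{k \to \infty} g(y^k) = c$. Here $\|\cdot\|$ is the Euclidean norm. The restriction $g : g^{-1}(U) \to U$ is a $C^\infty$ trivial fibration if there are a smooth manifold $F$ and a $C^\infty$ diffeomorphism $g^{-1}(U) \to F \times U$ whose composition with the projection to $U$ equals $g$. *)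

theory Defs
  imports "HOL-Analysis.Analysis"
begin

subsection \<open>Smooth functions between Euclidean spaces\<close>

text \<open>\<open>Ck_on k S f\<close> is meant for open \<open>S\<close>: all iterated directional derivatives of \<open>f\<close> of
  order at most \<open>k\<close> exist and are continuous on \<open>S\<close>.\<close>

primrec Ck_on :: "nat \<Rightarrow> 'a::euclidean_space set \<Rightarrow> ('a \<Rightarrow> 'b::real_normed_vector) \<Rightarrow> bool" where
  "Ck_on 0 S f \<longleftrightarrow> continuous_on S f"
| "Ck_on (Suc k) S f \<longleftrightarrow>
     (\<forall>x\<in>S. f differentiable (at x)) \<and> (\<forall>v. Ck_on k S (\<lambda>x. frechet_derivative f (at x) v))"

definition smooth_on :: "'a::euclidean_space set \<Rightarrow> ('a \<Rightarrow> 'b::real_normed_vector) \<Rightarrow> bool" where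
  "smooth_on S f \<longleftrightarrow> (\<forall>k. Ck_on k S f)"

text \<open>Smoothness on a set that need not be open in the ambient space. It is used for relatively
  open subsets \<open>S\<close> of a linear subspace \<open>E\<close>, where it is ordinary smoothness on the
  finite-dimensional vector space \<open>E\<close> (a local extension is obtained by composing with the
  orthogonal projection onto \<open>E\<close>).\<close>

definition loc_smooth_on :: "'a::euclidean_space set \<Rightarrow> ('a \<Rightarrow> 'b::real_normed_vector) \<Rightarrow> bool" where
  "loc_smooth_on S f \<longleftrightarrow>
     (\<forall>x\<in>S. \<exists>W h. open W \<and> x \<in> W \<and> smooth_on W h \<and> (\<forall>y\<in>S \<inter> W. h y = f y))"


subsection \<open>Smooth manifolds and diffeomorphisms\<close>

text \<open>An abstract space with an atlas. So that the dimension is not tied to a type, the charts take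
  values in a linear subspace \<open>model\<close> of a Euclidean space; the dimension of the manifold is
  the dimension of that subspace (possibly \<open>0\<close>). A chart is a pair of its domain and its map.\<close>

record ('a, 'e) smooth_space =
  top_of :: "'a topology"
  model :: "'e set"
  atlas :: "('a set \<times> ('a \<Rightarrow> 'e)) set"

definition smooth_manifold :: "('a, 'e::euclidean_space) smooth_space \<Rightarrow> bool" where
  "smooth_manifold M \<longleftrightarrow>
     Hausdorff_space (top_of M) \<and> second_countable (top_of M) \<and> subspace (model M) \<and>
     (\<Union>(V, \<phi>)\<in>atlas M. V) = topspace (top_of M) \<and>
     (\<forall>(V, \<phi>)\<in>atlas M. openin (top_of M) V \<and>
        openin (top_of_set (model M)) (\<phi> ` V) \<and>
        homeomorphic_map (subtopology (top_of M) V) (top_of_set (\<phi> ` V)) \<phi>) \<and>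
     (\<forall>(V, \<phi>)\<in>atlas M. \<forall>(W, \<psi>)\<in>atlas M.
        loc_smooth_on (\<phi> ` (V \<inter> W)) (\<psi> \<circ> inv_into V \<phi>))"

definition smooth_map ::
  "('a, 'e::euclidean_space) smooth_space \<Rightarrow> ('b, 'f::euclidean_space) smooth_space
     \<Rightarrow> ('a \<Rightarrow> 'b) \<Rightarrow> bool" where
  "smooth_map M N f \<longleftrightarrow>
     continuous_map (top_of M) (top_of N) f \<and>
     (\<forall>(V, \<phi>)\<in>atlas M. \<forall>(W, \<psi>)\<in>atlas N.
        loc_smooth_on (\<phi> ` {x \<in> V. f x \<in> W}) (\<psi> \<circ> f \<circ> inv_into V \<phi>))"

definition diffeomorphism ::
  "('a, 'e::euclidean_space) smooth_space \<Rightarrow> ('b, 'f::euclidean_space) smooth_space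
     \<Rightarrow> ('a \<Rightarrow> 'b) \<Rightarrow> bool" where
  "diffeomorphism M N f \<longleftrightarrow>
     smooth_map M N f \<and>
     (\<exists>h. smooth_map N M h \<and>
          (\<forall>x\<in>topspace (top_of M). h (f x) = x) \<and> (\<forall>y\<in>topspace (top_of N). f (h y) = y))"

definition euclidean_open :: "'a::euclidean_space set \<Rightarrow> ('a, 'a) smooth_space" where
  "euclidean_open W = \<lparr>top_of = top_of_set W, model = UNIV, atlas = {(W, id)}\<rparr>"

definition prod_space ::
  "('a, 'e) smooth_space \<Rightarrow> ('b, 'f) smooth_space \<Rightarrow> ('a \<times> 'b, 'e \<times> 'f) smooth_space" where
  "prod_space M N =
     \<lparr>top_of = prod_topology (top_of M) (top_of N),
      model = model M \<times> model N,
      atlas = {(V \<times> W, map_prod \<phi> \<psi>) | V \<phi> W \<psi>. (V, \<phi>) \<in> atlas M \<and> (W, \<psi>) \<in> atlas N}\<rparr>"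

text \<open>Taking the points and the chart values of \<open>F\<close> in the type \<open>'a\<close> is no restriction: a
  second countable manifold has at most continuum many points, and \<open>F \<times> U\<close> being
  diffeomorphic to a nonempty open subset of \<open>'a\<close> forces the dimension of \<open>F\<close> to be
  \<open>DIM('a) - 1\<close>. The topology and the atlas of \<open>F\<close> are unrelated to those of \<open>'a\<close>.\<close>

definition smooth_trivial_fibration ::
  "('a::euclidean_space \<Rightarrow> real) \<Rightarrow> real set \<Rightarrow> bool" where
  "smooth_trivial_fibration g U \<longleftrightarrow>
     (\<exists>(F :: ('a, 'a) smooth_space) \<Phi>.
        smooth_manifold F \<and>
        diffeomorphism (euclidean_open (g -` U)) (prod_space F (euclidean_open U)) \<Phi> \<and>
        (\<forall>x \<in> g -` U. snd (\<Phi> x) = g x))"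


subsection \<open>Critical values and asymptotic values\<close>

definition grad :: "('a::euclidean_space \<Rightarrow> real) \<Rightarrow> 'a \<Rightarrow> 'a" where
  "grad g x = (THE D. GDERIV g x :> D)"

lemma grad_eqI:
  assumes "GDERIV g x :> D"
  shows "grad g x = D"
  unfolding grad_def
proof (rule the_equality)
  fix D' assume "GDERIV g x :> D'"
  with assms have "(\<lambda>h. h \<bullet> D') = (\<lambda>h. h \<bullet> D)"
    unfolding gderiv_def by (blast intro: has_derivative_unique)
  then have "\<forall>h. h \<bullet> D' = h \<bullet> D"
    by (simp add: fun_eq_iff)
  then show "D' = D"
    by (simp only: vector_eq_ldot)
qed (fact assms)

definition crit_values :: "('a::euclidean_space \<Rightarrow> real) \<Rightarrow> real set" where
  "crit_values g = {g x | x. grad g x = 0}"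

definition radial_set :: "('a::euclidean_space \<Rightarrow> real) \<Rightarrow> 'a set" where
  "radial_set g = {x. \<exists>c::real. grad g x = c *\<^sub>R x}"

definition asymp_values :: "('a::euclidean_space \<Rightarrow> real) \<Rightarrow> real set" where
  "asymp_values g =
     {c. \<exists>y :: nat \<Rightarrow> 'a. (\<forall>k. y k \<in> radial_set g) \<and>
        filterlim (\<lambda>k. norm (y k)) at_top sequentially \<and> (\<lambda>k. g (y k)) \<longlonglongrightarrow> c}"

end

theory Submission
  imports Defs
begin

text \<open>
  The trivialization moves the points of \<open>\<Omega> = g -` U\<close> to a fixed level set along the integral
  curves of a vector field \<open>V\<close> with \<open>grad g \<bullet> V = 1\<close>: along such a curve the value of \<open>g\<close> grows at
  unit speed, so a point \<open>x\<close> reaches the level \<open>c\<close> at time \<open>c - g x\<close>, provided that the curve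
  does not escape to infinity before. This is where the two hypotheses enter. There are no critical
  values in \<open>U\<close>, so \<open>V\<close> can be found locally. There are no asymptotic values in \<open>U\<close> either, so
  over a compact \<open>J \<subseteq> U\<close> the gradient is nowhere radial outside some ball, and \<open>V\<close> can be chosen
  tangent to the spheres there. A curve over \<open>J\<close> then cannot leave the larger of this ball and the
  ball through its starting point. How far out the gradient can be radial depends on the level; a
  smooth function on \<open>U\<close> that majorizes this distance (\<open>smooth_majorant\<close>) allows one explicit
  formula for \<open>V\<close> on all of \<open>\<Omega>\<close> (\<open>level_field_exists\<close>).

  The analytic core is the smoothness of flows. For the flow of a globally Lipschitz field it is
  proved by induction on the order of differentiability (\<open>solves_ivp_Ck\<close>): the derivatives of a
  solution in the parameters solve an equation of the same kind. The step from continuity to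
  differentiability is Hadamard's: a difference of two solutions solves a linear equation with
  coefficients continuous in the increment. The field \<open>V\<close> itself is not Lipschitz, but over a compact
  interval of values it may be multiplied by a cutoff function (\<open>transport_box\<close>). The resulting pieces
  of the flow fit together by uniqueness of integral curves, and give a smooth map \<open>transport\<close> with
  \<open>transport (t, x)\<close> on the level \<open>t\<close>, and \<open>transport (s, transport (t, x)) = transport (s, x)\<close>.

  The map \<open>x \<mapsto> (transport (c, x), g x)\<close> with inverse \<open>(y, t) \<mapsto> transport (t, y)\<close> is then the
  trivialization, with the level set of \<open>c\<close> as fibre. Its atlas consists of restrictions of charts
  of the ambient space that have \<open>g\<close> as one coordinate (\<open>slice_chart_exists\<close>).
\<close>

section \<open>Calculus of iterated directional derivatives\<close>

lemma linear_basis_expansion: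
  fixes T :: "'a::euclidean_space \<Rightarrow> 'b::real_vector"
  assumes "linear T"
  shows "T v = (\<Sum>b\<in>Basis. (v \<bullet> b) *\<^sub>R T b)"
  using linear_sum[OF assms, of "\<lambda>b. (v \<bullet> b) *\<^sub>R b" Basis]
  by (simp add: euclidean_representation linear_scale[OF assms])

lemma Ck_on_imp_continuous_on: "Ck_on k S f \<Longrightarrow> continuous_on S f"
  by (cases k) (auto intro!: continuous_at_imp_continuous_on differentiable_imp_continuous_within)

lemma Ck_on_SucD: "Ck_on (Suc k) S f \<Longrightarrow> Ck_on k S f"
proof (induction k arbitrary: f)
  case 0
  then show ?case using Ck_on_imp_continuous_on by fastforce
next
  case (Suc k)
  then show ?case by (metis Ck_on.simps(2))
qed

lemma Ck_on_le: "Ck_on k S f \<Longrightarrow> m \<le> k \<Longrightarrow> Ck_on m S f"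
  by (induction k) (metis le_zero_eq, metis Ck_on_SucD le_Suc_eq)

lemma Ck_on_subset: "Ck_on k S f \<Longrightarrow> T \<subseteq> S \<Longrightarrow> Ck_on k T f"
  by (induction k arbitrary: f) (auto intro: continuous_on_subset)

lemma Ck_on_cong:
  assumes "open S" and "\<And>x. x \<in> S \<Longrightarrow> f x = g x" and "Ck_on k S f"
  shows "Ck_on k S g"
  using assms(2,3)
proof (induction k arbitrary: f g)
  case 0
  then show ?case by (simp cong: continuous_on_cong)
next
  case (Suc k)
  have D: "(g has_derivative frechet_derivative f (at x)) (at x)" if "x \<in> S" for x
    by (rule has_derivative_transform_within_open[OF _ assms(1) that, of f])
      (use Suc.prems that in \<open>auto simp: frechet_derivative_works[symmetric]\<close>)
  have "Ck_on k S (\<lambda>x. frechet_derivative g (at x) v)" for v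
  proof (rule Suc.IH)
    show "Ck_on k S (\<lambda>x. frechet_derivative f (at x) v)" using Suc.prems by simp
    show "\<And>x. x \<in> S \<Longrightarrow> frechet_derivative f (at x) v = frechet_derivative g (at x) v"
      using D frechet_derivative_at by metis
  qed
  then show ?case using D by (auto simp: differentiable_def)
qed

lemma Ck_on_SucI:
  assumes "open S" and D: "\<And>x. x \<in> S \<Longrightarrow> (f has_derivative D x) (at x)"
    and "\<And>v. Ck_on k S (\<lambda>x. D x v)"
  shows "Ck_on (Suc k) S f"
proof -
  have "Ck_on k S (\<lambda>x. frechet_derivative f (at x) v)" for v
    by (rule Ck_on_cong[OF assms(1) _ assms(3)[of v]]) (use D frechet_derivative_at in metis)
  then show ?thesis using D by (auto simp: differentiable_def)
qed

lemma Ck_on_has_derivative: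
  assumes "Ck_on (Suc k) S f" "x \<in> S"
  shows "(f has_derivative frechet_derivative f (at x)) (at x)"
  using assms frechet_derivative_works by auto

lemma Ck_on_local:
  assumes "open S" and "\<And>x. x \<in> S \<Longrightarrow> \<exists>W. open W \<and> x \<in> W \<and> Ck_on k W f"
  shows "Ck_on k S f"
  using assms(2)
proof (induction k arbitrary: f)
  case 0
  then show ?case
    by (metis Ck_on.simps(1) continuous_on_eq_continuous_at continuous_at_imp_continuous_on)
next
  case (Suc k)
  have "f differentiable at x" if "x \<in> S" for x using Suc.prems[OF that] by auto
  moreover have "Ck_on k S (\<lambda>x. frechet_derivative f (at x) v)" for v
    by (rule Suc.IH) (use Suc.prems in fastforce)
  ultimately show ?case by simp
qed

lemma Ck_on_const: "Ck_on k S (\<lambda>x. c)"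
  by (induction k arbitrary: c) auto

lemma Ck_on_bounded_linear:
  assumes "bounded_linear L" shows "Ck_on k S L"
proof (cases k)
  case 0
  then show ?thesis using assms by (simp add: linear_continuous_on)
next
  case (Suc m)
  have "(L has_derivative L) (at x)" for x
    using assms by (rule bounded_linear_imp_has_derivative)
  then have "Ck_on (Suc m) UNIV L" by (intro Ck_on_SucI) (auto intro: Ck_on_const)
  then show ?thesis using Suc Ck_on_subset by blast
qed

lemma Ck_on_linear_compose:
  assumes "open S" "bounded_linear L" "Ck_on k S f"
  shows "Ck_on k S (\<lambda>x. L (f x))"
  using assms(3)
proof (induction k arbitrary: f)
  case 0
  then show ?case using bounded_linear.continuous_on[OF assms(2)] by auto
next
  case (Suc k)
  show ?case
    by (rule Ck_on_SucI[OF assms(1)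
          bounded_linear.has_derivative[OF assms(2) Ck_on_has_derivative[OF Suc.prems]]])
      (use Suc in auto)
qed

lemma Ck_on_add:
  assumes "open S" "Ck_on k S f" "Ck_on k S g"
  shows "Ck_on k S (\<lambda>x. f x + g x)"
  using assms(2,3)
proof (induction k arbitrary: f g)
  case 0
  then show ?case by (auto intro: continuous_intros)
next
  case (Suc k)
  show ?case
    by (rule Ck_on_SucI[OF assms(1) has_derivative_add[OF Ck_on_has_derivative Ck_on_has_derivative]])
      (use Suc in auto)
qed

lemma Ck_on_sum:
  assumes "open S" "\<And>i. i \<in> I \<Longrightarrow> Ck_on k S (f i)"
  shows "Ck_on k S (\<lambda>x. \<Sum>i\<in>I. f i x)"
  using assms(2) by (induction I rule: infinite_finite_induct) (auto intro: Ck_on_const Ck_on_add[OF assms(1)])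

lemma Ck_on_bilinear:
  assumes "open S" "bounded_bilinear prd" "Ck_on k S f" "Ck_on k S g"
  shows "Ck_on k S (\<lambda>x. prd (f x) (g x))"
  using assms(3,4)
proof (induction k arbitrary: f g)
  case 0
  then show ?case by (auto intro: bounded_bilinear.continuous_on[OF assms(2)])
next
  case (Suc k)
  show ?case
    by (rule Ck_on_SucI[OF assms(1) bounded_bilinear.FDERIV[OF assms(2)
            Ck_on_has_derivative[OF Suc.prems(1)] Ck_on_has_derivative[OF Suc.prems(2)]]])
      (use Suc.prems Ck_on_SucD[OF Suc.prems(1)] Ck_on_SucD[OF Suc.prems(2)] in
        \<open>auto intro!: Ck_on_add[OF assms(1)] Suc.IH\<close>)
qed

lemma Ck_on_Pair:
  assumes "open S" "Ck_on k S f" "Ck_on k S g"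
  shows "Ck_on k S (\<lambda>x. (f x, g x))"
proof -
  have "Ck_on k S (\<lambda>x. (f x, 0) + (0, g x))"
    by (intro Ck_on_add[OF assms(1)] Ck_on_linear_compose[OF assms(1) _ assms(2), of "\<lambda>y. (y, 0)"]
        Ck_on_linear_compose[OF assms(1) _ assms(3), of "\<lambda>y. (0, y)"])
      (auto intro!: bounded_linear_Pair bounded_linear_ident bounded_linear_zero)
  then show ?thesis by simp
qed

text \<open>The chain rule gives the derivative of a composite in a direction \<open>v\<close> as a derivative of
  the outer map in a direction that moves with the point; expanding that direction in an
  orthonormal basis turns it into products of functions covered by the induction.\<close>

lemma Ck_on_compose:
  assumes "open S" "open T" "\<And>x. x \<in> S \<Longrightarrow> f x \<in> T"
    and "Ck_on k T h" "Ck_on k S f"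
  shows "Ck_on k S (\<lambda>x. h (f x))"
  using assms(4,5)
proof (induction k arbitrary: h)
  case 0
  then show ?case using assms(3) by (auto intro: continuous_on_compose2)
next
  case (Suc k)
  note Dh = Ck_on_has_derivative[OF Suc.prems(1)] and Df = Ck_on_has_derivative[OF Suc.prems(2)]
  show ?case
  proof (rule Ck_on_SucI[OF assms(1)])
    fix x assume x: "x \<in> S"
    show "((\<lambda>x. h (f x)) has_derivative (\<lambda>v. \<Sum>b\<in>Basis. (frechet_derivative f (at x) v \<bullet> b)
        *\<^sub>R frechet_derivative h (at (f x)) b)) (at x)"
    proof (rule has_derivative_eq_rhs[OF has_derivative_compose[OF Df[OF x] Dh[OF assms(3)[OF x]]]], rule ext)
      fix v
      have "linear (frechet_derivative h (at (f x)))"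
        using Dh[OF assms(3)[OF x]] has_derivative_linear by blast
      then show "frechet_derivative h (at (f x)) (frechet_derivative f (at x) v) =
          (\<Sum>b\<in>Basis. (frechet_derivative f (at x) v \<bullet> b) *\<^sub>R frechet_derivative h (at (f x)) b)"
        by (rule linear_basis_expansion)
    qed
  next
    fix v
    have "Ck_on k S (\<lambda>x. frechet_derivative f (at x) v)" using Suc.prems by simp
    then show "Ck_on k S (\<lambda>x. \<Sum>b\<in>Basis. (frechet_derivative f (at x) v \<bullet> b)
        *\<^sub>R frechet_derivative h (at (f x)) b)"
      using Suc.prems Ck_on_SucD
      by (intro Ck_on_sum[OF assms(1)] Ck_on_bilinear[OF assms(1) bounded_bilinear_scaleR]
          Ck_on_linear_compose[OF assms(1) bounded_linear_inner_left] Suc.IH) auto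
  qed
qed

lemma Ck_on_inverse:
  fixes f :: "'a::euclidean_space \<Rightarrow> real"
  assumes "open S" "\<And>x. x \<in> S \<Longrightarrow> f x \<noteq> 0" "Ck_on k S f"
  shows "Ck_on k S (\<lambda>x. inverse (f x))"
  using assms(3)
proof (induction k)
  case 0
  then show ?case using assms(2) by (auto intro!: continuous_intros)
next
  case (Suc k)
  note Df = Ck_on_has_derivative[OF Suc.prems]
  show ?case
  proof (rule Ck_on_SucI[OF assms(1)])
    show "((\<lambda>x. inverse (f x)) has_derivative
        (\<lambda>v. (inverse (f x) * inverse (f x)) * (- 1 * frechet_derivative f (at x) v))) (at x)"
      if "x \<in> S" for x
      by (rule has_derivative_eq_rhs[OF Deriv.has_derivative_inverse[OF assms(2)[OF that] Df[OF that]]])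
        (auto simp: algebra_simps)
    show "Ck_on k S (\<lambda>x. (inverse (f x) * inverse (f x)) * (- 1 * frechet_derivative f (at x) v))" for v
      using Suc Ck_on_SucD
      by (intro Ck_on_bilinear[OF assms(1) bounded_bilinear_mult] Ck_on_const) auto
  qed
qed

subsection \<open>Smooth maps\<close>

lemma smooth_on_imp_Ck_on: "smooth_on S f \<Longrightarrow> Ck_on k S f"
  by (simp add: smooth_on_def)

lemma smooth_on_imp_continuous_on: "smooth_on S f \<Longrightarrow> continuous_on S f"
  using Ck_on_imp_continuous_on smooth_on_def by blast

lemma smooth_on_has_derivative:
  assumes "smooth_on S f" "x \<in> S"
  shows "(f has_derivative frechet_derivative f (at x)) (at x)"
  using assms Ck_on_has_derivative smooth_on_def by blast

lemma smooth_on_frechet_derivative: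
  "smooth_on S f \<Longrightarrow> smooth_on S (\<lambda>x. frechet_derivative f (at x) v)"
  unfolding smooth_on_def by (metis Ck_on.simps(2))

lemma smooth_on_subset: "smooth_on S f \<Longrightarrow> T \<subseteq> S \<Longrightarrow> smooth_on T f"
  unfolding smooth_on_def using Ck_on_subset by blast

lemma smooth_on_cong: "open S \<Longrightarrow> (\<And>x. x \<in> S \<Longrightarrow> f x = g x) \<Longrightarrow> smooth_on S f \<Longrightarrow> smooth_on S g"
  unfolding smooth_on_def using Ck_on_cong by blast

lemma smooth_on_local:
  assumes "open S" and "\<And>x. x \<in> S \<Longrightarrow> \<exists>W. open W \<and> x \<in> W \<and> smooth_on W f"
  shows "smooth_on S f"
  unfolding smooth_on_def using assms Ck_on_local smooth_on_def by metis

lemma smooth_on_const: "smooth_on S (\<lambda>x. c)"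
  by (simp add: smooth_on_def Ck_on_const)

lemma smooth_on_bounded_linear: "bounded_linear L \<Longrightarrow> smooth_on S L"
  by (simp add: smooth_on_def Ck_on_bounded_linear)

lemma smooth_on_ident: "smooth_on S (\<lambda>x. x)"
  by (simp add: smooth_on_bounded_linear bounded_linear_ident)

context
  fixes S :: "'a::euclidean_space set"
  assumes S: "open S"
begin

lemma smooth_on_linear_compose:
  "bounded_linear L \<Longrightarrow> smooth_on S f \<Longrightarrow> smooth_on S (\<lambda>x. L (f x))"
  by (simp add: smooth_on_def Ck_on_linear_compose[OF S])

lemma smooth_on_add: "smooth_on S f \<Longrightarrow> smooth_on S g \<Longrightarrow> smooth_on S (\<lambda>x. f x + g x)"
  by (simp add: smooth_on_def Ck_on_add[OF S])

lemma smooth_on_sum: "(\<And>i. i \<in> I \<Longrightarrow> smooth_on S (f i)) \<Longrightarrow> smooth_on S (\<lambda>x. \<Sum>i\<in>I. f i x)"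
  by (simp add: smooth_on_def Ck_on_sum[OF S])

lemma smooth_on_uminus: "smooth_on S f \<Longrightarrow> smooth_on S (\<lambda>x. - f x)"
  by (rule smooth_on_linear_compose[OF bounded_linear_minus[OF bounded_linear_ident]])

lemma smooth_on_diff: "smooth_on S f \<Longrightarrow> smooth_on S g \<Longrightarrow> smooth_on S (\<lambda>x. f x - g x)"
  using smooth_on_add[of f "\<lambda>x. - g x", OF _ smooth_on_uminus[of g]] by simp

lemma smooth_on_scaleR: "smooth_on S f \<Longrightarrow> smooth_on S g \<Longrightarrow> smooth_on S (\<lambda>x. f x *\<^sub>R g x)"
  by (simp add: smooth_on_def Ck_on_bilinear[OF S bounded_bilinear_scaleR])

lemma smooth_on_mult:
  fixes f g :: "'a \<Rightarrow> 'b::real_normed_algebra"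
  shows "smooth_on S f \<Longrightarrow> smooth_on S g \<Longrightarrow> smooth_on S (\<lambda>x. f x * g x)"
  by (simp add: smooth_on_def Ck_on_bilinear[OF S bounded_bilinear_mult])

lemma smooth_on_inner: "smooth_on S f \<Longrightarrow> smooth_on S g \<Longrightarrow> smooth_on S (\<lambda>x. f x \<bullet> g x)"
  by (simp add: smooth_on_def Ck_on_bilinear[OF S bounded_bilinear_inner])

lemma smooth_on_Pair: "smooth_on S f \<Longrightarrow> smooth_on S g \<Longrightarrow> smooth_on S (\<lambda>x. (f x, g x))"
  by (simp add: smooth_on_def Ck_on_Pair[OF S])

lemma smooth_on_fst: "smooth_on S f \<Longrightarrow> smooth_on S (\<lambda>x. fst (f x))"
  by (rule smooth_on_linear_compose[OF bounded_linear_fst])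

lemma smooth_on_snd: "smooth_on S f \<Longrightarrow> smooth_on S (\<lambda>x. snd (f x))"
  by (rule smooth_on_linear_compose[OF bounded_linear_snd])

lemma smooth_on_inverse:
  fixes f :: "'a \<Rightarrow> real"
  shows "smooth_on S f \<Longrightarrow> (\<And>x. x \<in> S \<Longrightarrow> f x \<noteq> 0) \<Longrightarrow> smooth_on S (\<lambda>x. inverse (f x))"
  by (simp add: smooth_on_def Ck_on_inverse[OF S])

lemma smooth_on_compose:
  "open T \<Longrightarrow> smooth_on T h \<Longrightarrow> smooth_on S f \<Longrightarrow> (\<And>x. x \<in> S \<Longrightarrow> f x \<in> T)
    \<Longrightarrow> smooth_on S (\<lambda>x. h (f x))"
  unfolding smooth_on_def using Ck_on_compose[OF S] by blast

lemmas smooth_intros = smooth_on_const smooth_on_ident smooth_on_add smooth_on_sum smooth_on_uminus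
  smooth_on_diff smooth_on_scaleR smooth_on_mult smooth_on_inner smooth_on_Pair smooth_on_fst
  smooth_on_snd smooth_on_inverse

end

section \<open>Ordinary differential equations with a global Lipschitz condition\<close>

subsection \<open>Gronwall estimate and uniqueness\<close>

text \<open>By \<open>2 \<epsilon> \<bar>d\<bar> \<le> \<bar>d\<bar>\<^sup>2 + \<epsilon>\<^sup>2\<close> the derivative of \<open>\<bar>d\<bar>\<^sup>2\<close> is at most \<open>(2 L + 1) \<bar>d\<bar>\<^sup>2 + \<epsilon>\<^sup>2\<close>. The
  square of the norm is used because the norm is not differentiable at the zeros of \<open>d\<close>.\<close>

lemma gronwall_forward:
  fixes d :: "real \<Rightarrow> 'a::real_inner"
  assumes d: "\<And>s. 0 \<le> s \<Longrightarrow> s \<le> T \<Longrightarrow> (d has_vector_derivative d' s) (at s)"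
    and b: "\<And>s. 0 \<le> s \<Longrightarrow> s \<le> T \<Longrightarrow> norm (d' s) \<le> L * norm (d s) + \<epsilon>"
    and "0 \<le> L" "0 \<le> T"
  shows "norm (d T) ^ 2 \<le> (norm (d 0) ^ 2 + \<epsilon>^2 * T) * exp ((2 * L + 1) * T)"
proof -
  define c where "c = 2 * L + 1"
  define w where "w = (\<lambda>s. (d s \<bullet> d s))"
  define u where "u = (\<lambda>s. w s * exp (- c * s) - \<epsilon>^2 * s)"
  have c: "0 < c" using assms by (simp add: c_def)
  have w: "(w has_real_derivative 2 * (d s \<bullet> d' s)) (at s)" if "0 \<le> s" "s \<le> T" for s
    unfolding w_def has_field_derivative_def
    by (rule has_derivative_eq_rhs[OF has_derivative_inner[OF
            d[OF that, unfolded has_vector_derivative_def] d[OF that, unfolded has_vector_derivative_def]]])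
      (auto simp: inner_commute algebra_simps)
  have slope: "2 * (d s \<bullet> d' s) \<le> c * w s + \<epsilon>^2" if "0 \<le> s" "s \<le> T" for s
  proof -
    have "2 * (d s \<bullet> d' s) \<le> 2 * (norm (d s) * norm (d' s))"
      using norm_cauchy_schwarz by auto
    also have "\<dots> \<le> 2 * (norm (d s) * (L * norm (d s) + \<epsilon>))"
      using b[OF that] by (intro mult_left_mono) auto
    also have "\<dots> \<le> c * norm (d s)^2 + \<epsilon>^2"
      using zero_le_power2[of "norm (d s) - \<epsilon>"]
      by (simp add: c_def algebra_simps power2_eq_square)
    finally show ?thesis by (simp add: w_def dot_square_norm)
  qed
  have "u T \<le> u 0"
  proof (rule DERIV_nonpos_imp_nonincreasing[OF \<open>0 \<le> T\<close>])
    fix s assume s: "0 \<le> s" "s \<le> T"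
    have "(u has_real_derivative 2 * (d s \<bullet> d' s) * exp (- c * s) - c * w s * exp (- c * s) - \<epsilon>^2) (at s)"
      unfolding u_def by (rule derivative_eq_intros w[OF s] refl)+ (auto simp: algebra_simps)
    moreover have "2 * (d s \<bullet> d' s) * exp (- c * s) - c * w s * exp (- c * s) - \<epsilon>^2 \<le> 0"
    proof -
      have "(2 * (d s \<bullet> d' s) - c * w s) * exp (- c * s) \<le> \<epsilon>^2 * exp (- c * s)"
        using slope[OF s] by (intro mult_right_mono) auto
      also have "\<dots> \<le> \<epsilon>^2 * 1" using c s by (intro mult_left_mono) auto
      finally show ?thesis by (simp add: algebra_simps)
    qed
    ultimately show "\<exists>y. (u has_real_derivative y) (at s) \<and> y \<le> 0" by blast
  qed
  then have "w T * exp (- c * T) \<le> w 0 + \<epsilon>^2 * T" by (simp add: u_def)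
  then have "w T * exp (- c * T) * exp (c * T) \<le> (w 0 + \<epsilon>^2 * T) * exp (c * T)"
    by (intro mult_right_mono) auto
  also have "w T * exp (- c * T) * exp (c * T) = w T" by (simp add: mult.assoc flip: exp_add)
  finally show ?thesis by (simp add: w_def dot_square_norm c_def)
qed

lemma has_vector_derivative_comp_affine:
  assumes "(d has_vector_derivative d') (at (c + \<sigma> * s))"
  shows "((\<lambda>s. d (c + \<sigma> * s)) has_vector_derivative \<sigma> *\<^sub>R d') (at (s::real))"
proof -
  have "((\<lambda>s. c + \<sigma> * s) has_vector_derivative \<sigma>) (at s)"
    by (auto intro!: derivative_eq_intros)
  from vector_diff_chain_at[where g=d, OF this] show ?thesis using assms by (simp add: o_def)
qed

lemma gronwall:
  fixes d :: "real \<Rightarrow> 'a::real_inner"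
  assumes d: "\<And>s. s \<in> closed_segment c t \<Longrightarrow> (d has_vector_derivative d' s) (at s)"
    and b: "\<And>s. s \<in> closed_segment c t \<Longrightarrow> norm (d' s) \<le> L * norm (d s) + \<epsilon>"
    and "0 \<le> L"
  shows "norm (d t) ^ 2 \<le> (norm (d c) ^ 2 + \<epsilon>^2 * \<bar>t - c\<bar>) * exp ((2 * L + 1) * \<bar>t - c\<bar>)"
proof -
  define \<sigma> :: real where "\<sigma> = (if c \<le> t then 1 else -1)"
  have seg: "c + \<sigma> * s \<in> closed_segment c t" if "0 \<le> s" "s \<le> \<bar>t - c\<bar>" for s
    using that by (auto simp: \<sigma>_def closed_segment_eq_real_ivl)
  have "norm (d (c + \<sigma> * \<bar>t - c\<bar>)) ^ 2 \<le>
    (norm (d (c + \<sigma> * 0)) ^ 2 + \<epsilon>^2 * \<bar>t - c\<bar>) * exp ((2 * L + 1) * \<bar>t - c\<bar>)"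
  proof (rule gronwall_forward)
    fix s assume s: "0 \<le> s" "s \<le> \<bar>t - c\<bar>"
    show "((\<lambda>s. d (c + \<sigma> * s)) has_vector_derivative \<sigma> *\<^sub>R d' (c + \<sigma> * s)) (at s)"
      by (rule has_vector_derivative_comp_affine[OF d[OF seg[OF s]]])
    show "norm (\<sigma> *\<^sub>R d' (c + \<sigma> * s)) \<le> L * norm (d (c + \<sigma> * s)) + \<epsilon>"
      using b[OF seg[OF s]] by (simp add: \<sigma>_def split: if_splits)
  qed (use assms in auto)
  then show ?thesis by (simp add: \<sigma>_def split: if_splits)
qed

lemma ivp_unique:
  fixes y z :: "real \<Rightarrow> 'a::real_inner"
  assumes "\<And>s. s \<in> closed_segment c t \<Longrightarrow> (y has_vector_derivative f s (y s)) (at s)"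
    and "\<And>s. s \<in> closed_segment c t \<Longrightarrow> (z has_vector_derivative f s (z s)) (at s)"
    and "\<And>s u v. norm (f s u - f s v) \<le> L * norm (u - v)" and "y c = z c" and "0 \<le> L"
  shows "y t = z t"
proof -
  have "norm (y t - z t) ^ 2 \<le> (norm (y c - z c) ^ 2 + 0^2 * \<bar>t - c\<bar>) * exp ((2 * L + 1) * \<bar>t - c\<bar>)"
    by (rule gronwall[where d'="\<lambda>s. f s (y s) - f s (z s)"])
      (use assms in \<open>auto intro!: has_vector_derivative_diff\<close>)
  then show ?thesis using assms by simp
qed

subsection \<open>Existence\<close>

lemma antiderivative_exists:
  fixes g :: "real \<Rightarrow> 'a::banach"
  assumes g: "continuous_on UNIV g"
  shows "\<exists>G. G 0 = 0 \<and> (\<forall>t. (G has_vector_derivative g t) (at t))"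
proof -
  define G where "G = (\<lambda>t. integral {0..t} g - integral {t..0} g)"
  have "(G has_vector_derivative g t) (at t)" for t
  proof -
    define N where "N = \<bar>t\<bar> + 1"
    have int: "g integrable_on {a..b}" for a b
      using g continuous_on_subset integrable_continuous_real by blast
    have eq: "integral {-N..u} g - integral {-N..0} g = G u" if "u \<in> {-N<..<N}" for u
    proof (cases "0 \<le> u")
      case True
      then show ?thesis
        using Henstock_Kurzweil_Integration.integral_combine[of "-N" 0 u g] int that
        by (cases "u = 0") (auto simp: G_def algebra_simps N_def)
    next
      case False
      then show ?thesis
        using Henstock_Kurzweil_Integration.integral_combine[of "-N" u 0 g] int that
        by (auto simp: G_def algebra_simps)
    qed
    have "((\<lambda>u. integral {-N..u} g) has_vector_derivative g t) (at t within {-N..N})"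
      by (rule integral_has_vector_derivative) (use g continuous_on_subset in \<open>auto simp: N_def\<close>)
    then have "((\<lambda>u. integral {-N..u} g) has_vector_derivative g t) (at t)"
      by (subst (asm) at_within_interior) (auto simp: N_def)
    then have "((\<lambda>u. integral {-N..u} g - integral {-N..0} g) has_vector_derivative g t) (at t)"
      by (auto intro!: derivative_eq_intros)
    then show ?thesis
      by (rule has_vector_derivative_transform_within_open[of _ _ _ "{-N<..<N}"])
        (use eq in \<open>auto simp: N_def\<close>)
  qed
  moreover have "G 0 = 0" by (simp add: G_def)
  ultimately show ?thesis by blast
qed

text \<open>The gain \<open>1 / c\<close> is what turns the Picard operator into a contraction below.\<close>

lemma exp_growth_bound:
  fixes H :: "real \<Rightarrow> 'a::euclidean_space"
  assumes "\<And>s. (H has_vector_derivative h s) (at s)" and "H 0 = 0"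
    and "\<And>s. norm (h s) \<le> K * exp (c * \<bar>s\<bar>)" and "0 < c" "0 \<le> K"
  shows "norm (H t) \<le> K / c * exp (c * \<bar>t\<bar>)"
proof -
  define \<sigma> :: real where "\<sigma> = sgn t"
  show ?thesis
  proof (cases "t = 0")
    case True then show ?thesis using assms by simp
  next
    case False
    define \<phi> where "\<phi> = (\<lambda>s. K / c * exp (c * s))"
    have "norm (H (0 + \<sigma> * \<bar>t\<bar>) - H (0 + \<sigma> * 0)) \<le> \<phi> \<bar>t\<bar> - \<phi> 0"
    proof (rule differentiable_bound_general[where f' = "\<lambda>s. \<sigma> *\<^sub>R h (0 + \<sigma> * s)" and \<phi>' = "\<lambda>s. K * exp (c * s)"])
      have D: "((\<lambda>s. H (0 + \<sigma> * s)) has_vector_derivative \<sigma> *\<^sub>R h (0 + \<sigma> * s)) (at s)" for s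
        by (rule has_vector_derivative_comp_affine[OF assms(1)])
      then show "((\<lambda>s. H (0 + \<sigma> * s)) has_vector_derivative \<sigma> *\<^sub>R h (0 + \<sigma> * s)) (at s)" for s .
      show "continuous_on {0..\<bar>t\<bar>} (\<lambda>s. H (0 + \<sigma> * s))"
        by (intro continuous_at_imp_continuous_on ballI has_vector_derivative_continuous[OF D])
      show "continuous_on {0..\<bar>t\<bar>} \<phi>" unfolding \<phi>_def by (intro continuous_intros)
      have "(\<phi> has_real_derivative K * exp (c * s)) (at s)" for s
        unfolding \<phi>_def using assms(4) by (auto intro!: derivative_eq_intros)
      then show "(\<phi> has_vector_derivative K * exp (c * s)) (at s)" for s
        by (simp add: has_real_derivative_iff_has_vector_derivative)
      show "norm (\<sigma> *\<^sub>R h (0 + \<sigma> * s)) \<le> K * exp (c * s)" if "0 < s" for s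
        using assms(3)[of "\<sigma> * s"] False that by (auto simp: \<sigma>_def sgn_if split: if_splits)
    qed (use False in auto)
    then have "norm (H t) \<le> \<phi> \<bar>t\<bar> - \<phi> 0" using assms(2) by (simp add: \<sigma>_def sgn_mult_abs)
    also have "\<dots> \<le> \<phi> \<bar>t\<bar>" using assms by (simp add: \<phi>_def)
    finally show ?thesis by (simp add: \<phi>_def)
  qed
qed

text \<open>On continuous functions with the norm \<open>sup \<bar>y t\<bar> exp (- 2 L \<bar>t\<bar>)\<close> the Picard operator is a
  contraction with factor \<open>1/2\<close>, for all time at once. The weight is carried by passing to the
  bounded function \<open>y t * exp (- 2 L \<bar>t\<bar>)\<close>.\<close>

lemma ivp_exists_bounded:
  fixes f :: "real \<Rightarrow> 'a::euclidean_space \<Rightarrow> 'a"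
  assumes cont: "continuous_on UNIV (\<lambda>(t, x). f t x)"
    and lip: "\<And>t u v. norm (f t u - f t v) \<le> L * norm (u - v)" and L: "0 < L"
    and B: "\<And>t. norm (f t 0) \<le> B"
  shows "\<exists>y. y 0 = x0 \<and> (\<forall>t. (y has_vector_derivative f t (y t)) (at t))"
proof -
  define c where "c = 2 * L"
  have c: "0 < c" using L by (simp add: c_def)
  define g where "g = (\<lambda>(z::real \<Rightarrow>\<^sub>C 'a) s. f s (exp (c * \<bar>s\<bar>) *\<^sub>R z s))"
  have "continuous_on UNIV (g z)" for z
    unfolding g_def
    by (rule continuous_on_compose2[OF cont, of UNIV "\<lambda>s. (s, exp (c * \<bar>s\<bar>) *\<^sub>R z s)", simplified])
      (intro continuous_intros continuous_on_apply_bcontfun)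
  then have "\<exists>G. G 0 = 0 \<and> (\<forall>t. (G has_vector_derivative g z t) (at t))" for z
    by (rule antiderivative_exists)
  then obtain G where G0: "\<And>z. G z 0 = 0"
    and G: "\<And>z t. (G z has_vector_derivative g z t) (at t)"
    by metis
  define P where "P = (\<lambda>z t. exp (- c * \<bar>t\<bar>) *\<^sub>R (x0 + G z t))"
  have "P z \<in> bcontfun" for z
  proof -
    have "continuous_on UNIV (G z)"
      using G by (meson continuous_at_imp_continuous_on has_vector_derivative_continuous)
    then have "continuous_on UNIV (P z)" unfolding P_def by (intro continuous_intros)
    moreover have "norm (P z t) \<le> norm x0 + (B + L * norm z) / c" for t
    proof -
      have "norm (g z s) \<le> (B + L * norm z) * exp (c * \<bar>s\<bar>)" for s
      proof -
        have "norm (g z s) \<le> norm (f s 0) + L * norm (exp (c * \<bar>s\<bar>) *\<^sub>R z s - 0)"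
          unfolding g_def using lip[of s "exp (c * \<bar>s\<bar>) *\<^sub>R z s" 0]
            norm_triangle_sub[of "f s (exp (c * \<bar>s\<bar>) *\<^sub>R z s)" "f s 0"] by linarith
        also have "\<dots> \<le> B * exp (c * \<bar>s\<bar>) + L * (exp (c * \<bar>s\<bar>) * norm z)"
        proof (intro add_mono mult_left_mono)
          have "0 \<le> B" using B norm_ge_zero order_trans by blast
          then have "B * 1 \<le> B * exp (c * \<bar>s\<bar>)" using c by (intro mult_left_mono) auto
          then show "norm (f s 0) \<le> B * exp (c * \<bar>s\<bar>)" using B[of s] by simp
          show "norm (exp (c * \<bar>s\<bar>) *\<^sub>R z s - 0) \<le> exp (c * \<bar>s\<bar>) * norm z"
            using norm_bounded[of z s] by simp
        qed (use L in auto)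
        finally show ?thesis by (simp add: algebra_simps)
      qed
      then have "norm (G z t) \<le> (B + L * norm z) / c * exp (c * \<bar>t\<bar>)"
        by (rule exp_growth_bound[OF G G0])
          (use c L B[of 0] in \<open>auto intro!: add_nonneg_nonneg intro: order_trans[OF norm_ge_zero]\<close>)
      then have "norm (x0 + G z t) \<le> norm x0 * exp (c * \<bar>t\<bar>) + (B + L * norm z) / c * exp (c * \<bar>t\<bar>)"
        using c by (intro norm_triangle_mono) (auto simp: mult_le_cancel_left1)
      then have "exp (- c * \<bar>t\<bar>) * norm (x0 + G z t)
          \<le> exp (- c * \<bar>t\<bar>) * ((norm x0 + (B + L * norm z) / c) * exp (c * \<bar>t\<bar>))"
        by (intro mult_left_mono) (auto simp: algebra_simps)
      also have "\<dots> = norm x0 + (B + L * norm z) / c"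
        by (simp add: exp_minus field_simps)
      finally show ?thesis by (simp add: P_def)
    qed
    ultimately show ?thesis unfolding bcontfun_def bounded_iff by blast
  qed
  then have P: "apply_bcontfun (Bcontfun (P z)) = P z" for z by (rule Bcontfun_inverse)
  have "\<exists>!z. Bcontfun (P z) = z"
  proof (rule banach_fix_type[where c="1/2"])
    show "\<forall>z w. dist (Bcontfun (P z)) (Bcontfun (P w)) \<le> 1 / 2 * dist z w"
    proof (intro allI dist_bound)
      fix z w t
      have "norm (g z s - g w s) \<le> (L * dist z w) * exp (c * \<bar>s\<bar>)" for s
      proof -
        have "norm (g z s - g w s) \<le> L * norm (exp (c * \<bar>s\<bar>) *\<^sub>R z s - exp (c * \<bar>s\<bar>) *\<^sub>R w s)"
          unfolding g_def by (rule lip)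
        also have "\<dots> = L * (exp (c * \<bar>s\<bar>) * dist (z s) (w s))"
          by (simp add: dist_norm flip: scaleR_diff_right)
        also have "\<dots> \<le> L * (exp (c * \<bar>s\<bar>) * dist z w)"
          using L dist_bounded[of z s w] by (intro mult_left_mono) auto
        finally show ?thesis by (simp add: algebra_simps)
      qed
      then have "norm (G z t - G w t) \<le> (L * dist z w) / c * exp (c * \<bar>t\<bar>)"
        by (intro exp_growth_bound[where H="\<lambda>t. G z t - G w t" and h="\<lambda>s. g z s - g w s"])
          (use c L in \<open>auto intro!: has_vector_derivative_diff G simp: G0\<close>)
      then have "exp (- c * \<bar>t\<bar>) * norm (G z t - G w t)
          \<le> exp (- c * \<bar>t\<bar>) * ((L * dist z w) / c * exp (c * \<bar>t\<bar>))"
        by (intro mult_left_mono) auto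
      also have "\<dots> = dist z w / 2"
        using L by (simp add: exp_minus field_simps c_def)
      finally show "dist (Bcontfun (P z) t) (Bcontfun (P w) t) \<le> 1 / 2 * dist z w"
        unfolding P by (simp add: P_def dist_norm flip: scaleR_diff_right)
    qed
  qed auto
  then obtain z where "Bcontfun (P z) = z" by blast
  then have z: "apply_bcontfun z = P z" using P by metis
  define y where "y = (\<lambda>t. x0 + G z t)"
  have "g z = (\<lambda>t. f t (y t))"
    by (simp add: g_def z P_def y_def exp_minus)
  then have "(y has_vector_derivative f t (y t)) (at t)" for t
    using G[of z t] by (auto simp: y_def intro!: derivative_eq_intros)
  then show ?thesis by (auto simp: y_def G0 intro!: exI[of _ y])
qed

text \<open>The right hand side may grow in time. Freezing time outside \<open>[- T, T]\<close> bounds it, and the solutions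
  obtained for different \<open>T\<close> agree by uniqueness.\<close>

theorem ivp_exists:
  fixes f :: "real \<Rightarrow> 'a::euclidean_space \<Rightarrow> 'a"
  assumes cont: "continuous_on UNIV (\<lambda>(t, x). f t x)"
    and lip: "\<And>t u v. norm (f t u - f t v) \<le> L * norm (u - v)" and L: "0 < L"
  shows "\<exists>y. y 0 = x0 \<and> (\<forall>t. (y has_vector_derivative f t (y t)) (at t))"
proof -
  define fT where "fT = (\<lambda>T t. f (max (- T) (min T t)))"
  have "\<exists>y. y 0 = x0 \<and> (\<forall>t. (y has_vector_derivative fT T t (y t)) (at t))" for T
  proof -
    have "bounded ((\<lambda>t. f t 0) ` {-\<bar>T\<bar>..\<bar>T\<bar>})"
      by (intro compact_imp_bounded compact_continuous_image
          continuous_on_compose2[OF cont, of _ "\<lambda>s. (s, 0)", simplified] continuous_intros) auto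
    then obtain B where B: "\<forall>t\<in>{-\<bar>T\<bar>..\<bar>T\<bar>}. norm (f t 0) \<le> B"
      by (auto simp: bounded_iff)
    then have "norm (f t 0) \<le> \<bar>B\<bar>" if "\<bar>t\<bar> \<le> \<bar>T\<bar>" for t
      using that by (force simp: abs_le_iff intro: order_trans[OF _ abs_ge_self])
    then have "norm (fT T t 0) \<le> \<bar>B\<bar>" for t by (simp add: fT_def)
    then show ?thesis
    proof (intro ivp_exists_bounded[where L=L and B="\<bar>B\<bar>"])
      show "continuous_on UNIV (\<lambda>(t, x). fT T t x)"
        using continuous_on_compose2[OF cont, of UNIV "\<lambda>z. (max (- T) (min T (fst z)), snd z)"]
        by (simp add: fT_def case_prod_beta continuous_intros)
    qed (use lip L in \<open>auto simp: fT_def\<close>)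
  qed
  then obtain Y where Y0: "\<And>T. Y T 0 = x0"
    and Y: "\<And>T t. (Y T has_vector_derivative fT T t (Y T t)) (at t)" by metis
  have Yf: "(Y T has_vector_derivative f t (Y T t)) (at t)" if "\<bar>t\<bar> \<le> T" for T t
  proof -
    have "max (- T) (min T t) = t" using that by auto
    then show ?thesis using Y[of T t] by (simp add: fT_def)
  qed
  have agree: "Y T t = Y T' t" if "\<bar>t\<bar> \<le> T" "\<bar>t\<bar> \<le> T'" for T T' t
    by (rule ivp_unique[where c=0 and f=f and L=L])
      (use that L lip Y0 in \<open>auto intro!: Yf simp: closed_segment_eq_real_ivl split: if_splits\<close>)
  define y where "y = (\<lambda>t. Y (\<bar>t\<bar> + 1) t)"
  have "(y has_vector_derivative f t (y t)) (at t)" for t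
  proof -
    have eq: "Y (\<bar>t\<bar> + 2) s = y s" if "s \<in> {t-1<..<t+1}" for s
      unfolding y_def using that by (intro agree) auto
    then have "(Y (\<bar>t\<bar> + 2) has_vector_derivative f t (y t)) (at t)"
      using Yf[of t "\<bar>t\<bar> + 2"] by simp
    then show ?thesis
      by (rule has_vector_derivative_transform_within_open[of _ _ _ "{t-1<..<t+1}"]) (use eq in auto)
  qed
  then show ?thesis by (auto simp: y_def Y0 intro!: exI[of _ y])
qed

subsection \<open>Continuous dependence on parameters\<close>

text \<open>Time, parameter and state are collected in one argument \<open>(t, p, x)\<close> of the right hand side.\<close>

definition state_lipschitz :: "real \<Rightarrow> (real \<times> 'p \<times> 'a \<Rightarrow> 'a::real_normed_vector) \<Rightarrow> bool" where
  "state_lipschitz L f \<longleftrightarrow> (\<forall>t p u v. norm (f (t, p, u) - f (t, p, v)) \<le> L * norm (u - v))"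

definition solves_ivp ::
  "(real \<times> 'p \<times> 'a \<Rightarrow> 'a) \<Rightarrow> ('p \<Rightarrow> 'a::real_normed_vector) \<Rightarrow> (real \<times> 'p \<Rightarrow> 'a) \<Rightarrow> bool" where
  "solves_ivp f y0 y \<longleftrightarrow> (\<forall>p. y (0, p) = y0 p) \<and>
     (\<forall>t p. ((\<lambda>t. y (t, p)) has_vector_derivative f (t, p, y (t, p))) (at t))"

lemma solves_ivp_exists:
  fixes f :: "real \<times> 'p::topological_space \<times> 'a::euclidean_space \<Rightarrow> 'a"
  assumes "continuous_on UNIV f" "state_lipschitz L f" "0 < L"
  shows "\<exists>y. solves_ivp f y0 y"
proof -
  have "\<exists>y. y 0 = y0 p \<and> (\<forall>t. (y has_vector_derivative f (t, p, y t)) (at t))" for p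
  proof (rule ivp_exists[where L=L])
    show "continuous_on UNIV (\<lambda>(t, x). f (t, p, x))"
      unfolding case_prod_beta
      by (rule continuous_on_compose2[OF assms(1)]) (auto intro!: continuous_intros)
  qed (use assms(2,3) in \<open>auto simp: state_lipschitz_def\<close>)
  then obtain y where "\<And>p. y p 0 = y0 p" "\<And>p t. (y p has_vector_derivative f (t, p, y p t)) (at t)"
    by metis
  then have "solves_ivp f y0 (\<lambda>(t, p). y p t)" by (simp add: solves_ivp_def)
  then show ?thesis by blast
qed

text \<open>On a compact time interval \<open>f\<close> changes little along the fixed solution for \<open>p0\<close> when \<open>p0\<close> is
  replaced by a close parameter; this change is the error term \<open>\<epsilon>\<close> in the Gronwall estimate.\<close>

lemma solves_ivp_continuous:
  fixes f :: "real \<times> 'p::euclidean_space \<times> 'a::euclidean_space \<Rightarrow> 'a"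
  assumes f: "continuous_on UNIV f" and lip: "state_lipschitz L f" and L: "0 < L"
    and y0: "continuous_on UNIV y0" and y: "solves_ivp f y0 y"
  shows "continuous_on UNIV y"
proof -
  have D: "((\<lambda>t. y (t, p)) has_vector_derivative f (t, p, y (t, p))) (at t)" for t p
    using y by (auto simp: solves_ivp_def)
  have yt: "continuous_on UNIV (\<lambda>t. y (t, p))" for p
    using D by (meson continuous_at_imp_continuous_on has_vector_derivative_continuous)
  have "isCont y (t0, p0)" for t0 p0
    unfolding isCont_def tendsto_iff
  proof (intro allI impI)
    fix e :: real assume e: "0 < e"
    define T where "T = \<bar>t0\<bar> + 1"
    define C where "C = (1 + T) * exp ((2 * L + 1) * T)"
    have C: "0 < C" unfolding C_def T_def by (intro mult_pos_pos) auto
    define \<epsilon> where "\<epsilon> = e / (2 * sqrt C)"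
    have \<epsilon>: "0 < \<epsilon>" using e C by (simp add: \<epsilon>_def)
    have "continuous_on (UNIV \<times> {-T..T}) (\<lambda>(p, s). f (s, p, y (s, p0)))"
      by (auto simp: case_prod_beta
          intro!: continuous_intros continuous_on_compose2[OF f] continuous_on_compose2[OF yt])
    from continuous_on_prod_compactE[OF this compact_Icc UNIV_I \<epsilon>, of p0]
    obtain N where N: "p0 \<in> N" "open N"
      "\<forall>p\<in>N. \<forall>s\<in>{-T..T}. dist (f (s, p, y (s, p0))) (f (s, p0, y (s, p0))) \<le> \<epsilon>"
      by auto
    have est: "dist (y (t, p)) (y (t, p0)) \<le> e / 2"
      if p: "p \<in> N" "dist (y0 p) (y0 p0) < \<epsilon>" and t: "\<bar>t\<bar> \<le> T" for t p
    proof -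
      have "norm (y (t, p) - y (t, p0)) ^ 2
        \<le> (norm (y (0, p) - y (0, p0)) ^ 2 + \<epsilon>^2 * \<bar>t - 0\<bar>) * exp ((2 * L + 1) * \<bar>t - 0\<bar>)"
      proof (rule gronwall)
        show "((\<lambda>t. y (t, p) - y (t, p0)) has_vector_derivative
            f (s, p, y (s, p)) - f (s, p0, y (s, p0))) (at s)" for s
          by (intro has_vector_derivative_diff D)
        fix s assume s: "s \<in> closed_segment 0 t"
        have "norm (f (s, p, y (s, p)) - f (s, p0, y (s, p0)))
            \<le> norm (f (s, p, y (s, p)) - f (s, p, y (s, p0))) + norm (f (s, p, y (s, p0)) - f (s, p0, y (s, p0)))"
          by (rule order_trans[OF _ norm_triangle_ineq]) simp
        also have "\<dots> \<le> L * norm (y (s, p) - y (s, p0)) + \<epsilon>"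
          using lip N p s t by (intro add_mono)
            (auto simp: state_lipschitz_def dist_norm closed_segment_eq_real_ivl split: if_splits)
        finally show "norm (f (s, p, y (s, p)) - f (s, p0, y (s, p0)))
            \<le> L * norm (y (s, p) - y (s, p0)) + \<epsilon>" .
      qed (use L in auto)
      also have "\<dots> \<le> (\<epsilon>^2 + \<epsilon>^2 * T) * exp ((2 * L + 1) * T)"
        using t L p y T_def \<epsilon>
        by (intro mult_mono add_mono power_mono) (auto simp: solves_ivp_def dist_norm)
      also have "\<dots> = \<epsilon>^2 * C" by (simp add: C_def algebra_simps)
      also have "\<dots> = (e / 2)^2" using C by (simp add: \<epsilon>_def power_divide power_mult_distrib)
      finally show ?thesis using e by (simp add: dist_norm power2_le_iff_abs_le)
    qed
    have "\<forall>\<^sub>F q in at (t0, p0). snd q \<in> N"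
      using N by (intro topological_tendstoD[where f=snd and l=p0]) (auto intro!: tendsto_eq_intros)
    moreover have "((\<lambda>q. y0 (snd q)) \<longlongrightarrow> y0 p0) (at (t0, p0))"
      using isContD[OF continuous_on_interior[OF continuous_on_compose2[OF y0 continuous_on_snd[OF continuous_on_id]]],
          where x="(t0, p0)"] by (metis UNIV_I fst_conv interior_UNIV snd_conv subset_UNIV)
    then have "\<forall>\<^sub>F q in at (t0, p0). dist (y0 (snd q)) (y0 p0) < \<epsilon>" using \<epsilon> tendstoD by blast
    moreover have "((\<lambda>q. y (fst q, p0)) \<longlongrightarrow> y (t0, p0)) (at (t0, p0))"
      using isContD[OF continuous_on_interior[OF continuous_on_compose2[OF yt continuous_on_fst[OF continuous_on_id]]],
          where x="(t0, p0)"] by (metis UNIV_I fst_conv interior_UNIV snd_conv subset_UNIV)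
    then have "\<forall>\<^sub>F q in at (t0, p0). dist (y (fst q, p0)) (y (t0, p0)) < e / 2"
      using e tendstoD half_gt_zero by blast
    moreover have "\<forall>\<^sub>F q in at (t0, p0). fst q \<in> {-T<..<T}"
      by (intro topological_tendstoD[where f=fst and l=t0]) (auto simp: T_def intro!: tendsto_eq_intros)
    ultimately show "\<forall>\<^sub>F q in at (t0, p0). dist (y q) (y (t0, p0)) < e"
    proof eventually_elim
      case (elim q)
      obtain t p where q: "q = (t, p)" by force
      have "dist (y (t, p)) (y (t, p0)) \<le> e / 2" using elim q by (intro est) auto
      then show ?case using elim dist_triangle[of "y q" "y (t0, p0)" "y (t, p0)"] q by auto
    qed
  qed
  then show ?thesis by (auto simp: continuous_on_eq_continuous_at)
qed

subsection \<open>Hadamard's integral form of the difference quotient\<close>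

text \<open>The mean over the segment from \<open>x\<close> to \<open>x + h\<close> depends linearly on \<open>v\<close> and continuously on
  \<open>(x, h)\<close>, also at \<open>h = 0\<close>, where it is the derivative at \<open>x\<close>; for \<open>v = h\<close> it is the increment of \<open>f\<close>.
  So it replaces the difference quotient without dividing by \<open>h\<close>.\<close>

definition mean_derivative ::
  "('a::euclidean_space \<Rightarrow> 'b::banach) \<Rightarrow> 'a \<Rightarrow> 'a \<Rightarrow> 'a \<Rightarrow> 'b" where
  "mean_derivative f x h v = integral {0..1} (\<lambda>\<theta>. frechet_derivative f (at (x + \<theta> *\<^sub>R h)) v)"

context
  fixes f :: "'a::euclidean_space \<Rightarrow> 'b::banach"
  assumes f: "Ck_on (Suc 0) UNIV f"
begin

lemma C1_derivative: "(f has_derivative frechet_derivative f (at x)) (at x)"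
  by (rule Ck_on_has_derivative[OF f UNIV_I])

lemma C1_continuous: "continuous_on UNIV (\<lambda>x. frechet_derivative f (at x) v)"
  using f by simp

lemma mean_derivative_integrable:
  "(\<lambda>\<theta>. frechet_derivative f (at (x + \<theta> *\<^sub>R h)) v) integrable_on {0..1}"
  by (intro integrable_continuous_real continuous_on_compose2[OF C1_continuous] continuous_intros) auto

lemma mean_derivative_fundamental: "f (x + h) = f x + mean_derivative f x h h"
proof -
  have D: "((\<lambda>\<theta>. f (x + \<theta> *\<^sub>R h)) has_vector_derivative frechet_derivative f (at (x + \<theta> *\<^sub>R h)) h) (at \<theta> within {0..1})"
    for \<theta>
  proof -
    have "((\<lambda>\<theta>. f (x + \<theta> *\<^sub>R h)) has_derivative (\<lambda>s. frechet_derivative f (at (x + \<theta> *\<^sub>R h)) (s *\<^sub>R h))) (at \<theta> within {0..1})"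
      by (rule has_derivative_compose[OF _ C1_derivative]) (auto intro!: derivative_eq_intros)
    then show ?thesis
      by (simp add: has_vector_derivative_def linear_scale[OF has_derivative_linear[OF C1_derivative]])
  qed
  have "((\<lambda>\<theta>. frechet_derivative f (at (x + \<theta> *\<^sub>R h)) h) has_integral f (x + 1 *\<^sub>R h) - f (x + 0 *\<^sub>R h)) {0..1}"
    by (rule fundamental_theorem_of_calculus) (use D in auto)
  then show ?thesis by (simp add: mean_derivative_def integral_unique)
qed

lemma mean_derivative_zero: "mean_derivative f x 0 v = frechet_derivative f (at x) v"
  by (simp add: mean_derivative_def)

lemma mean_derivative_linear: "linear (mean_derivative f x h)"
  by (rule linearI)
    (simp_all add: mean_derivative_def linear_add[OF has_derivative_linear[OF C1_derivative]]
      linear_scale[OF has_derivative_linear[OF C1_derivative]] mean_derivative_integrable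
      Henstock_Kurzweil_Integration.integral_add)

lemma mean_derivative_continuous_basis:
  "continuous_on UNIV (\<lambda>z. mean_derivative f (fst z) (snd z) v)"
proof -
  have "continuous_on UNIV (\<lambda>z. integral (cbox 0 1) (\<lambda>\<theta>. frechet_derivative f (at (fst z + \<theta> *\<^sub>R snd z)) v))"
    by (rule integral_continuous_on_param)
      (auto simp: case_prod_beta intro!: continuous_on_compose2[OF C1_continuous] continuous_intros)
  then show ?thesis by (simp add: mean_derivative_def)
qed

lemma mean_derivative_continuous:
  assumes "continuous_on S a" "continuous_on S b" "continuous_on S c"
  shows "continuous_on S (\<lambda>z. mean_derivative f (a z) (b z) (c z))"
proof -
  have "mean_derivative f (a z) (b z) (c z) = (\<Sum>e\<in>Basis. (c z \<bullet> e) *\<^sub>R mean_derivative f (a z) (b z) e)" for z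
    by (rule linear_basis_expansion[OF mean_derivative_linear])
  moreover have "continuous_on S (\<lambda>z. mean_derivative f (a z) (b z) e)" for e
    using continuous_on_compose2[OF mean_derivative_continuous_basis continuous_on_Pair[OF assms(1,2)]] by simp
  ultimately show ?thesis by (auto intro!: continuous_intros assms)
qed

lemma norm_mean_derivative_le:
  assumes "\<And>x s. norm (f (x + s *\<^sub>R v) - f x) \<le> K * \<bar>s\<bar>"
  shows "norm (mean_derivative f x h v) \<le> K"
proof -
  have D: "norm (frechet_derivative f (at x) v) \<le> K" for x
  proof -
    have "((\<lambda>s. f (x + s *\<^sub>R v)) has_vector_derivative frechet_derivative f (at x) v) (at 0)"
    proof -
      have "((\<lambda>s. x + s *\<^sub>R v) has_derivative (\<lambda>s. s *\<^sub>R v)) (at 0)"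
        by (auto intro!: derivative_eq_intros)
      from has_derivative_compose[OF this, of f "frechet_derivative f (at x)"] C1_derivative[of x]
      show ?thesis
        by (simp add: has_vector_derivative_def linear_scale[OF has_derivative_linear[OF C1_derivative]])
    qed
    then have lim0: "((\<lambda>s. (f (x + s *\<^sub>R v) - f x - s *\<^sub>R frechet_derivative f (at x) v) /\<^sub>R \<bar>s\<bar>) \<longlongrightarrow> 0) (at 0)"
      by (simp add: has_vector_derivative_def has_derivative_def)
    then have lim: "((\<lambda>s. K + norm ((f (x + s *\<^sub>R v) - f x - s *\<^sub>R frechet_derivative f (at x) v) /\<^sub>R \<bar>s\<bar>)) \<longlongrightarrow> K) (at 0)"
      using tendsto_add[OF tendsto_const[of K] tendsto_norm_zero[OF lim0]] by simp
    show ?thesis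
    proof (rule tendsto_lowerbound[OF lim])
      have "norm (frechet_derivative f (at x) v)
          \<le> K + norm ((f (x + s *\<^sub>R v) - f x - s *\<^sub>R frechet_derivative f (at x) v) /\<^sub>R \<bar>s\<bar>)" if "s \<noteq> 0" for s
      proof -
        have "norm (s *\<^sub>R frechet_derivative f (at x) v)
            \<le> norm (f (x + s *\<^sub>R v) - f x) + norm (f (x + s *\<^sub>R v) - f x - s *\<^sub>R frechet_derivative f (at x) v)"
          by (metis norm_minus_commute norm_triangle_sub)
        also have "\<dots> \<le> K * \<bar>s\<bar> + norm (f (x + s *\<^sub>R v) - f x - s *\<^sub>R frechet_derivative f (at x) v)"
          using assms[of x s] by simp
        finally have "norm (frechet_derivative f (at x) v)
            \<le> K + norm (f (x + s *\<^sub>R v) - f x - s *\<^sub>R frechet_derivative f (at x) v) / \<bar>s\<bar>"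
          using that by (simp add: field_simps)
        then show ?thesis by (simp only: norm_scaleR abs_inverse abs_abs divide_inverse_commute)
      qed
      then show "\<forall>\<^sub>F s in at 0. norm (frechet_derivative f (at x) v)
          \<le> K + norm ((f (x + s *\<^sub>R v) - f x - s *\<^sub>R frechet_derivative f (at x) v) /\<^sub>R \<bar>s\<bar>)"
        by (auto simp: eventually_at intro!: exI[of _ 1])
    qed simp
  qed
  show ?thesis
    unfolding mean_derivative_def
  proof (rule order_trans[OF integral_bound])
    show "continuous_on {0..1} (\<lambda>\<theta>. frechet_derivative f (at (x + \<theta> *\<^sub>R h)) v)"
      by (intro continuous_on_compose2[OF C1_continuous] continuous_intros) auto
  qed (use D in auto)
qed

end

lemma norm_mean_derivative_state:
  fixes f :: "real \<times> 'p::euclidean_space \<times> 'a::euclidean_space \<Rightarrow> 'a"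
  assumes f: "Ck_on (Suc 0) UNIV f" and lip: "state_lipschitz L f"
  shows "norm (mean_derivative f x h (0, 0, q)) \<le> L * norm q"
proof (rule norm_mean_derivative_le[OF f])
  fix x :: "real \<times> 'p \<times> 'a" and s :: real
  obtain t p u where x: "x = (t, p, u)" by (metis prod.exhaust)
  have "norm (f (t, p, u + s *\<^sub>R q) - f (t, p, u)) \<le> L * norm (u + s *\<^sub>R q - u)"
    using lip unfolding state_lipschitz_def by blast
  then show "norm (f (x + s *\<^sub>R (0, 0, q)) - f x) \<le> L * norm q * \<bar>s\<bar>"
    by (simp add: x algebra_simps)
qed

text \<open>The converse, in Caratheodory's form: each summand is the product of a linear function of \<open>h\<close> and a
  function continuous at \<open>0\<close>, and such a product is differentiable at \<open>0\<close>.\<close>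

lemma has_derivative_of_increment:
  fixes f :: "'a::euclidean_space \<Rightarrow> 'b::real_normed_vector"
  assumes inc: "\<And>h. f (x + h) = f x + (\<Sum>b\<in>Basis. (h \<bullet> b) *\<^sub>R A b h)"
    and cont: "\<And>b. b \<in> Basis \<Longrightarrow> isCont (A b) 0"
  shows "(f has_derivative (\<lambda>h. \<Sum>b\<in>Basis. (h \<bullet> b) *\<^sub>R A b 0)) (at x)"
proof -
  have "((\<lambda>h. (h \<bullet> b) *\<^sub>R A b h) has_derivative (\<lambda>h. (h \<bullet> b) *\<^sub>R A b 0)) (at 0)" if b: "b \<in> Basis" for b
    unfolding has_derivative_at
  proof
    show "bounded_linear (\<lambda>h. (h \<bullet> b) *\<^sub>R A b 0)"
      by (intro bounded_linear_scaleR_const bounded_linear_inner_left)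
    have "((\<lambda>h. norm (A b h - A b 0)) \<longlongrightarrow> 0) (at 0)"
      using cont[OF b] by (auto simp: isCont_def intro!: tendsto_eq_intros)
    then show "((\<lambda>h. norm (((0 + h) \<bullet> b) *\<^sub>R A b (0 + h) - (0 \<bullet> b) *\<^sub>R A b 0 - (h \<bullet> b) *\<^sub>R A b 0) / norm h) \<longlongrightarrow> 0) (at 0)"
    proof (rule Lim_null_comparison[rotated])
      show "\<forall>\<^sub>F h in at 0. norm (norm (((0 + h) \<bullet> b) *\<^sub>R A b (0 + h) - (0 \<bullet> b) *\<^sub>R A b 0 - (h \<bullet> b) *\<^sub>R A b 0) / norm h)
          \<le> norm (A b h - A b 0)"
        using Basis_le_norm[OF b]
        by (intro always_eventually allI)
          (auto simp: divide_le_eq mult.commute[of "norm (A b _ - _)"] intro!: mult_right_mono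
            simp flip: scaleR_diff_right)
    qed
  qed
  then have "((\<lambda>h. \<Sum>b\<in>Basis. (h \<bullet> b) *\<^sub>R A b h) has_derivative (\<lambda>h. \<Sum>b\<in>Basis. (h \<bullet> b) *\<^sub>R A b 0)) (at 0)"
    by (rule has_derivative_sum)
  then have "((\<lambda>h. f (x + h)) has_derivative (\<lambda>h. \<Sum>b\<in>Basis. (h \<bullet> b) *\<^sub>R A b 0)) (at 0)"
    unfolding inc using has_derivative_add[OF has_derivative_const[of "f x"]] by simp
  then have "((\<lambda>h. f (x + h)) has_derivative (\<lambda>h. \<Sum>b\<in>Basis. (h \<bullet> b) *\<^sub>R A b 0)) (at (x - x))" by simp
  moreover have "((\<lambda>y. y - x) has_derivative (\<lambda>h. h)) (at x)"
    by (auto intro!: derivative_eq_intros)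
  ultimately show ?thesis
    using has_derivative_compose[where f="\<lambda>y. y - x" and g="\<lambda>h. f (x + h)"] by fastforce
qed

subsection \<open>Smooth dependence on time and parameters\<close>

text \<open>The difference \<open>y (t, p + h) - y (t, p)\<close> of two solutions solves a linear equation whose
  coefficients are Hadamard means of the derivative of \<open>f\<close> between the two solutions. These
  coefficients are continuous in \<open>h\<close>, up to and including \<open>h = 0\<close>, so continuous dependence on
  parameters, applied with \<open>(p, h)\<close> as parameter, already yields differentiability.\<close>

lemma solves_ivp_differentiable:
  fixes f :: "real \<times> 'p::euclidean_space \<times> 'a::euclidean_space \<Rightarrow> 'a"
  assumes f: "Ck_on (Suc 0) UNIV f" and lip: "state_lipschitz L f" and L: "0 < L"
    and y0: "Ck_on (Suc 0) UNIV y0" and y: "solves_ivp f y0 y"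
  obtains z where
    "\<And>b. solves_ivp (\<lambda>(t, p, q). frechet_derivative f (at (t, p, y (t, p))) (0, b, q))
            (\<lambda>p. frechet_derivative y0 (at p) b) (z b)"
    "\<And>t p. (y has_derivative (\<lambda>(\<tau>, w). \<tau> *\<^sub>R f (t, p, y (t, p)) + (\<Sum>b\<in>Basis. (w \<bullet> b) *\<^sub>R z b (t, p)))) (at (t, p))"
proof -
  note mean_linear = mean_derivative_linear[OF f]
  have fc: "continuous_on UNIV f" and y0c: "continuous_on UNIV y0"
    using f y0 Ck_on_imp_continuous_on by blast+
  have yc: "continuous_on UNIV y" by (rule solves_ivp_continuous[OF fc lip L y0c y])
  note yc' = continuous_on_compose2[OF yc]
  have D: "((\<lambda>t. y (t, p)) has_vector_derivative f (t, p, y (t, p))) (at t)"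
    and yinit: "y (0, p) = y0 p" for t p
    using y by (auto simp: solves_ivp_def)
  \<comment> \<open>the linear equation for \<open>\<delta>\<close>, with the direction \<open>v\<close> of the parameter kept apart from the
    increment \<open>h\<close> so that its solutions depend linearly on \<open>v\<close>\<close>
  define \<delta> where "\<delta> = (\<lambda>t p h. y (t, p + h) - y (t, p))"
  define G where "G = (\<lambda>v (t, ph, q).
    mean_derivative f (t, fst ph, y (t, fst ph)) (0, snd ph, \<delta> t (fst ph) (snd ph)) (0, v, q))"
  have Gc: "continuous_on UNIV (G v)" for v
    unfolding G_def \<delta>_def case_prod_beta
    by (intro mean_derivative_continuous[OF f] continuous_intros yc') auto
  have Glip: "state_lipschitz L (G v)" for v
    unfolding state_lipschitz_def
  proof (intro allI)
    fix t :: real and ph :: "'p \<times> 'p" and q r :: 'a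
    have "(0, v, q) - (0, v, r) = (0::real, 0::'p, q - r)" by simp
    then have "G v (t, ph, q) - G v (t, ph, r) =
      mean_derivative f (t, fst ph, y (t, fst ph)) (0, snd ph, \<delta> t (fst ph) (snd ph)) (0, 0, q - r)"
      unfolding G_def by (simp flip: linear_diff[OF mean_linear])
    also have "norm \<dots> \<le> L * norm (q - r)"
      by (rule norm_mean_derivative_state[OF f lip])
    finally show "norm (G v (t, ph, q) - G v (t, ph, r)) \<le> L * norm (q - r)" .
  qed
  define init where "init = (\<lambda>v ph. mean_derivative y0 (fst ph) (snd ph) v)"
  have "\<exists>Q. solves_ivp (G v) (init v) Q" for v
    by (rule solves_ivp_exists[OF Gc Glip L])
  then obtain Q where Q: "\<And>v. solves_ivp (G v) (init v) (Q v)" by metis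
  have Qc: "continuous_on UNIV (Q v)" for v
    by (rule solves_ivp_continuous[OF Gc Glip L _ Q])
      (auto simp: init_def intro!: mean_derivative_continuous_basis[OF y0])
  \<comment> \<open>for \<open>v = h\<close> the linear equation is the one that \<open>\<delta>\<close> solves\<close>
  have increment: "y (t, p + h) = y (t, p) + (\<Sum>b\<in>Basis. (h \<bullet> b) *\<^sub>R Q b (t, p, h))" for t p h
  proof -
    define R where "R = (\<lambda>t. \<Sum>b\<in>Basis. (h \<bullet> b) *\<^sub>R Q b (t, p, h))"
    have "\<delta> t p h = R t"
    proof (rule ivp_unique[where c=0 and f="\<lambda>t q. G h (t, (p, h), q)" and L=L])
      fix s
      have "f (s, p + h, y (s, p + h)) = f ((s, p, y (s, p)) + (0, h, \<delta> s p h))" by (simp add: \<delta>_def)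
      also have "\<dots> = f (s, p, y (s, p)) + G h (s, (p, h), \<delta> s p h)"
        by (subst mean_derivative_fundamental[OF f]) (simp add: G_def)
      finally show "((\<lambda>t. \<delta> t p h) has_vector_derivative G h (s, (p, h), \<delta> s p h)) (at s)"
        unfolding \<delta>_def using has_vector_derivative_diff[OF D[of "p + h" s] D[of p s]] by simp
      have "(R has_vector_derivative (\<Sum>b\<in>Basis. (h \<bullet> b) *\<^sub>R G b (s, (p, h), Q b (s, p, h)))) (at s)"
        unfolding R_def using Q
        by (auto simp: solves_ivp_def intro!: derivative_eq_intros)
      moreover have "(\<Sum>b\<in>Basis. (h \<bullet> b) *\<^sub>R G b (s, (p, h), Q b (s, p, h))) = G h (s, (p, h), R s)"
      proof -
        have "(\<Sum>b\<in>Basis. (h \<bullet> b) *\<^sub>R (0::real, b, Q b (s, p, h))) = (0, h, R s)"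
          by (simp add: sum_prod R_def euclidean_representation)
        then show ?thesis
          by (simp add: G_def flip: linear_scale[OF mean_linear] linear_sum[OF mean_linear])
      qed
      ultimately show "(R has_vector_derivative G h (s, (p, h), R s)) (at s)" by simp
      show "norm (G h (s, (p, h), u) - G h (s, (p, h), v)) \<le> L * norm (u - v)" for u v
        using Glip unfolding state_lipschitz_def by blast
    next
      have "\<delta> 0 p h = mean_derivative y0 p h h"
        using mean_derivative_fundamental[OF y0, of p h] by (simp add: \<delta>_def yinit)
      also have "\<dots> = R 0"
        using Q linear_basis_expansion[OF mean_derivative_linear[OF y0], of p h h]
        by (simp add: R_def solves_ivp_def init_def)
      finally show "\<delta> 0 p h = R 0" .
    qed (use L in auto)
    then show ?thesis by (simp add: \<delta>_def R_def algebra_simps)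
  qed
  define z where "z = (\<lambda>b (t, p). Q b (t, p, 0))"
  show thesis
  proof
    have "G b (t, (p, 0), q) = frechet_derivative f (at (t, p, y (t, p))) (0, b, q)" for b t p q
      using mean_derivative_zero[OF f] by (simp add: G_def \<delta>_def flip: zero_prod_def)
    then show "solves_ivp (\<lambda>(t, p, q). frechet_derivative f (at (t, p, y (t, p))) (0, b, q))
            (\<lambda>p. frechet_derivative y0 (at p) b) (z b)" for b
      using Q[of b] mean_derivative_zero[OF y0]
      by (simp add: solves_ivp_def z_def init_def split_paired_all) metis
    fix t p
    have "((\<lambda>(p, t). y (t, p)) has_derivative
        (\<lambda>(w, \<tau>). (\<Sum>b\<in>Basis. (w \<bullet> b) *\<^sub>R Q b (t, p, 0)) + blinfun_scaleR_left (f (t, p, y (t, p))) \<tau>))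
        (at (p, t) within UNIV \<times> UNIV)"
    proof (rule has_derivative_partialsI[where fy="\<lambda>p t. blinfun_scaleR_left (f (t, p, y (t, p)))"])
      show "((\<lambda>p. y (t, p)) has_derivative (\<lambda>w. \<Sum>b\<in>Basis. (w \<bullet> b) *\<^sub>R Q b (t, p, 0))) (at p)"
      proof (rule has_derivative_of_increment[where A="\<lambda>b h. Q b (t, p, h)"])
        show "isCont (\<lambda>h. Q b (t, p, h)) 0" for b
          using continuous_on_compose2[OF Qc, of UNIV "\<lambda>h. (t, p, h)" b]
          by (simp add: continuous_on_eq_continuous_at continuous_intros)
      qed (rule increment)
      show "((\<lambda>t. y (t, p)) has_derivative blinfun_apply (blinfun_scaleR_left (f (t, p, y (t, p))))) (at t)" for t p
        using D[of p t] by (simp add: has_vector_derivative_def)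
      have "continuous_on UNIV (\<lambda>(p, t). blinfun_scaleR_left (f (t, p, y (t, p))))"
        unfolding case_prod_beta
        by (intro bounded_linear.continuous_on[OF bounded_linear_blinfun_scaleR_left]
            continuous_on_compose2[OF fc] continuous_intros yc') auto
      then show "continuous (at (p, t) within UNIV \<times> UNIV) (\<lambda>(p, t). blinfun_scaleR_left (f (t, p, y (t, p))))"
        by (simp add: continuous_on_eq_continuous_at)
    qed auto
    then have "((\<lambda>(p, t). y (t, p)) has_derivative
        (\<lambda>(w, \<tau>). \<tau> *\<^sub>R f (t, p, y (t, p)) + (\<Sum>b\<in>Basis. (w \<bullet> b) *\<^sub>R z b (t, p))))
        (at (snd (t, p), fst (t, p)))"
      by (simp add: z_def add.commute case_prod_beta')
    moreover have "((\<lambda>x. (snd x, fst x)) has_derivative (\<lambda>x. (snd x, fst x))) (at (t, p))"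
      by (auto intro!: derivative_eq_intros)
    ultimately have "((\<lambda>x. (\<lambda>(p, t). y (t, p)) (snd x, fst x)) has_derivative
        (\<lambda>x. (\<lambda>(w, \<tau>). \<tau> *\<^sub>R f (t, p, y (t, p)) + (\<Sum>b\<in>Basis. (w \<bullet> b) *\<^sub>R z b (t, p))) (snd x, fst x)))
        (at (t, p))"
      by (rule has_derivative_compose[rotated])
    then
    show "(y has_derivative (\<lambda>(\<tau>, w). \<tau> *\<^sub>R f (t, p, y (t, p)) + (\<Sum>b\<in>Basis. (w \<bullet> b) *\<^sub>R z b (t, p)))) (at (t, p))"
      by (simp add: case_prod_beta')
  qed
qed

text \<open>The derivatives of a solution in the parameters solve equations of the same shape, over the same
  parameter and state spaces and with the same Lipschitz constant. So the order of
  differentiability can be raised by induction.\<close>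

lemma solves_ivp_Ck:
  fixes f :: "real \<times> 'p::euclidean_space \<times> 'a::euclidean_space \<Rightarrow> 'a"
  assumes "Ck_on k UNIV f" "state_lipschitz L f" "0 < L" "Ck_on k UNIV y0" "solves_ivp f y0 y"
  shows "Ck_on k UNIV y"
  using assms
proof (induction k arbitrary: f y0 y)
  case 0
  then show ?case using solves_ivp_continuous by (metis Ck_on.simps(1))
next
  case (Suc k)
  have f1: "Ck_on (Suc 0) UNIV f" and y01: "Ck_on (Suc 0) UNIV y0"
    using Ck_on_le[OF Suc.prems(1), of "Suc 0"] Ck_on_le[OF Suc.prems(4), of "Suc 0"] by blast+
  have fk: "Ck_on k UNIV f" and y0k: "Ck_on k UNIV y0" using Suc.prems Ck_on_SucD by blast+
  have yk: "Ck_on k UNIV y" by (rule Suc.IH[OF fk Suc.prems(2,3) y0k Suc.prems(5)])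
  obtain z where
    z: "\<And>b. solves_ivp (\<lambda>(t, p, q). frechet_derivative f (at (t, p, y (t, p))) (0, b, q))
            (\<lambda>p. frechet_derivative y0 (at p) b) (z b)"
    and D: "\<And>t p. (y has_derivative (\<lambda>(\<tau>, w). \<tau> *\<^sub>R f (t, p, y (t, p)) + (\<Sum>b\<in>Basis. (w \<bullet> b) *\<^sub>R z b (t, p)))) (at (t, p))"
    using solves_ivp_differentiable[OF f1 Suc.prems(2,3) y01 Suc.prems(5)] by blast
  have graph: "Ck_on k UNIV (\<lambda>x :: real \<times> 'p \<times> 'a. h (fst x, fst (snd x), y (fst x, fst (snd x))))"
    if "Ck_on k UNIV h" for h :: "real \<times> 'p \<times> 'a \<Rightarrow> 'a"
  proof (rule Ck_on_compose[OF open_UNIV open_UNIV UNIV_I that,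
        where f="\<lambda>x :: real \<times> 'p \<times> 'a. (fst x, fst (snd x), y (fst x, fst (snd x)))"])
    have l: "Ck_on k UNIV (\<lambda>x :: real \<times> 'p \<times> 'a. fst x)" "Ck_on k UNIV (\<lambda>x :: real \<times> 'p \<times> 'a. fst (snd x))"
      by (intro Ck_on_bounded_linear bounded_linear_fst bounded_linear_fst_comp bounded_linear_snd)+
    then have "Ck_on k UNIV (\<lambda>x :: real \<times> 'p \<times> 'a. y (fst x, fst (snd x)))"
      by (intro Ck_on_compose[OF open_UNIV open_UNIV UNIV_I yk] Ck_on_Pair open_UNIV)
    then show "Ck_on k UNIV (\<lambda>x :: real \<times> 'p \<times> 'a. (fst x, fst (snd x), y (fst x, fst (snd x))))"
      using l by (intro Ck_on_Pair open_UNIV)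
  qed
  have zk: "Ck_on k UNIV (z b)" for b
  proof (rule Suc.IH[OF _ _ Suc.prems(3) _ z])
    define F where "F = (\<lambda>(t, p, q). frechet_derivative f (at (t, p, y (t, p))) (0, b, q))"
    have lin: "linear (frechet_derivative f (at x))" for x
      using C1_derivative[OF f1] has_derivative_linear by blast
    \<comment> \<open>\<open>F\<close> is affine in the state, with coefficients that are \<open>k\<close> times differentiable in \<open>(t, p)\<close>,
      because \<open>y\<close> is so by the induction hypothesis\<close>
    have "F x = frechet_derivative f (at (fst x, fst (snd x), y (fst x, fst (snd x)))) (0, b, 0)
       + (\<Sum>e\<in>Basis. (snd (snd x) \<bullet> e) *\<^sub>R
            frechet_derivative f (at (fst x, fst (snd x), y (fst x, fst (snd x)))) (0, 0, e))" for x
    proof -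
      define D where "D = frechet_derivative f (at (fst x, fst (snd x), y (fst x, fst (snd x))))"
      have D: "linear D" by (simp add: D_def lin)
      have "linear (\<lambda>q. D (0, 0, q))"
        using linear_add[OF D] linear_scale[OF D]
        by (intro linearI) (metis add.left_neutral add_Pair, metis scaleR_Pair scaleR_zero_right)
      from linear_basis_expansion[OF this, of "snd (snd x)"]
      have "D (0, b, snd (snd x)) = D (0, b, 0) + (\<Sum>e\<in>Basis. (snd (snd x) \<bullet> e) *\<^sub>R D (0, 0, e))"
        using linear_add[OF D, of "(0, b, 0)" "(0, 0, snd (snd x))"] by simp
      then show ?thesis by (simp add: F_def D_def case_prod_beta)
    qed
    then have "F = (\<lambda>x. frechet_derivative f (at (fst x, fst (snd x), y (fst x, fst (snd x)))) (0, b, 0)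
       + (\<Sum>e\<in>Basis. (snd (snd x) \<bullet> e) *\<^sub>R
            frechet_derivative f (at (fst x, fst (snd x), y (fst x, fst (snd x)))) (0, 0, e)))" by blast
    moreover have "Ck_on k UNIV \<dots>"
    proof (intro Ck_on_add Ck_on_sum Ck_on_bilinear[OF _ bounded_bilinear_scaleR] open_UNIV)
      have "Ck_on k UNIV (\<lambda>x. frechet_derivative f (at x) v)" for v using Suc.prems(1) by (simp del: split_paired_All)
      note g = graph[OF this]
      show "Ck_on k UNIV (\<lambda>x :: real \<times> 'p \<times> 'a.
          frechet_derivative f (at (fst x, fst (snd x), y (fst x, fst (snd x)))) (0, b, 0))"
        and "Ck_on k UNIV (\<lambda>x :: real \<times> 'p \<times> 'a.
          frechet_derivative f (at (fst x, fst (snd x), y (fst x, fst (snd x)))) (0, 0, e))" for e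
        by (rule g)+
      show "Ck_on k UNIV (\<lambda>x :: real \<times> 'p \<times> 'a. snd (snd x) \<bullet> e)" for e
        by (intro Ck_on_bounded_linear bounded_linear_compose[OF bounded_linear_inner_left]
            bounded_linear_snd_comp bounded_linear_snd)
    qed
    ultimately show "Ck_on k UNIV (\<lambda>(t, p, q). frechet_derivative f (at (t, p, y (t, p))) (0, b, q))"
      unfolding F_def by metis
    show "state_lipschitz L (\<lambda>(t, p, q). frechet_derivative f (at (t, p, y (t, p))) (0, b, q))"
      unfolding state_lipschitz_def
    proof (intro allI)
      fix t p and q r :: 'a
      have "(0, b, q) - (0, b, r) = (0::real, 0::'p, q - r)" by simp
      then have "frechet_derivative f (at (t, p, y (t, p))) (0, b, q) - frechet_derivative f (at (t, p, y (t, p))) (0, b, r)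
        = mean_derivative f (t, p, y (t, p)) 0 (0, 0, q - r)"
        by (simp add: mean_derivative_zero[OF f1] flip: linear_diff[OF lin])
      also have "norm \<dots> \<le> L * norm (q - r)"
        by (rule norm_mean_derivative_state[OF f1 Suc.prems(2)])
      finally show "norm ((case (t, p, q) of (t, p, q) \<Rightarrow> frechet_derivative f (at (t, p, y (t, p))) (0, b, q))
          - (case (t, p, r) of (t, p, q) \<Rightarrow> frechet_derivative f (at (t, p, y (t, p))) (0, b, q))) \<le> L * norm (q - r)"
        by simp
    qed
    show "Ck_on k UNIV (\<lambda>p. frechet_derivative y0 (at p) b)" using Suc.prems by simp
  qed
  show ?case
  proof (rule Ck_on_SucI)
    show "(y has_derivative (\<lambda>v. fst v *\<^sub>R f (fst x, snd x, y x) + (\<Sum>b\<in>Basis. (snd v \<bullet> b) *\<^sub>R z b x))) (at x)" for x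
      using D[of "fst x" "snd x"] by (simp add: case_prod_beta')
    have "Ck_on k UNIV (\<lambda>x. f (fst x, snd x, y x))"
      by (intro Ck_on_compose[OF open_UNIV open_UNIV UNIV_I fk] Ck_on_Pair yk Ck_on_bounded_linear
          bounded_linear_fst bounded_linear_snd open_UNIV)
    then show "Ck_on k UNIV (\<lambda>x. fst v *\<^sub>R f (fst x, snd x, y x) + (\<Sum>b\<in>Basis. (snd v \<bullet> b) *\<^sub>R z b x))" for v
      by (intro Ck_on_add Ck_on_sum Ck_on_linear_compose[OF _ bounded_linear_scaleR_right] zk) auto
  qed auto
qed

theorem smooth_flow_exists:
  fixes X :: "'a::euclidean_space \<Rightarrow> 'a"
  assumes X: "smooth_on UNIV X" and lip: "\<And>u v. norm (X u - X v) \<le> L * norm (u - v)" and L: "0 < L"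
  obtains \<phi> where "smooth_on UNIV \<phi>" "\<And>x. \<phi> (0, x) = x"
    "\<And>t x. ((\<lambda>t. \<phi> (t, x)) has_vector_derivative X (\<phi> (t, x))) (at t)"
proof -
  define f where "f = (\<lambda>x :: real \<times> 'a \<times> 'a. X (snd (snd x)))"
  have f: "Ck_on k UNIV f" for k
    unfolding f_def
    by (rule Ck_on_compose[OF _ _ _ smooth_on_imp_Ck_on[OF X]])
      (auto intro!: Ck_on_bounded_linear bounded_linear_snd_comp bounded_linear_snd)
  have fl: "state_lipschitz L f" using lip by (simp add: state_lipschitz_def f_def)
  obtain \<phi> where \<phi>: "solves_ivp f (\<lambda>x. x) \<phi>"
    using solves_ivp_exists[OF _ fl L] f[of 0] by auto
  have "Ck_on k UNIV \<phi>" for k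
    by (rule solves_ivp_Ck[OF f fl L _ \<phi>]) (rule Ck_on_bounded_linear[OF bounded_linear_ident])
  then show thesis
    using \<phi> that[of \<phi>] by (auto simp: smooth_on_def solves_ivp_def f_def)
qed

section \<open>Smooth cutoff functions\<close>

text \<open>The functions \<open>t\<^sup>-\<^sup>n exp (- 1 / t)\<close> for \<open>t > 0\<close>, continued by \<open>0\<close>. The whole family is needed since its
  span is closed under differentiation, unlike that of \<open>exp (- 1 / t)\<close> alone.\<close>

definition flat_exp :: "nat \<Rightarrow> real \<Rightarrow> real" where
  "flat_exp n t = (if t \<le> 0 then 0 else inverse t ^ n / exp (inverse t))"

lemma flat_exp_nonneg: "0 \<le> flat_exp n t"
  by (simp add: flat_exp_def)

lemma flat_exp_pos_iff: "0 < flat_exp n t \<longleftrightarrow> 0 < t"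
  by (simp add: flat_exp_def)

lemma flat_exp_tendsto_0: "(flat_exp n \<longlongrightarrow> 0) (at 0)"
proof -
  have "((\<lambda>t::real. inverse t ^ n / exp (inverse t)) \<longlongrightarrow> 0) (at_right 0)"
    by (rule filterlim_compose[OF tendsto_power_div_exp_0 filterlim_inverse_at_top_right])
  then have "(flat_exp n \<longlongrightarrow> 0) (at_right 0)"
    by (rule Lim_transform_eventually) (auto simp: eventually_at_filter flat_exp_def)
  moreover have "(flat_exp n \<longlongrightarrow> 0) (at_left 0)"
    by (rule tendsto_eventually) (auto simp: eventually_at_filter flat_exp_def)
  ultimately show ?thesis by (simp add: filterlim_at_split)
qed

lemma flat_exp_has_derivative:
  "(flat_exp n has_real_derivative flat_exp (n + 2) t - real n * flat_exp (n + 1) t) (at t)"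
proof -
  consider "t < 0" | "t = 0" | "0 < t" by linarith
  then show ?thesis
  proof cases
    case 1
    have "((\<lambda>_. 0) has_real_derivative 0) (at t)" by simp
    then have "(flat_exp n has_real_derivative 0) (at t)"
      by (rule has_field_derivative_transform_within_open[of _ _ _ "{..<0}"])
        (use 1 in \<open>auto simp: flat_exp_def\<close>)
    then show ?thesis using 1 by (simp add: flat_exp_def)
  next
    case 2
    have "((\<lambda>h. (flat_exp n (0 + h) - flat_exp n 0) / h) \<longlongrightarrow> 0) (at 0)"
      by (rule Lim_transform_eventually[OF flat_exp_tendsto_0[of "Suc n"]])
        (auto simp: eventually_at_filter flat_exp_def divide_inverse)
    then show ?thesis using 2 by (simp add: DERIV_def flat_exp_def)
  next
    case 3
    define u where "u = inverse t"
    have inv: "(inverse has_real_derivative - (u * u)) (at t)"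
      using 3 by (auto intro!: derivative_eq_intros simp: u_def)
    have "((\<lambda>t. inverse t ^ n * exp (- inverse t)) has_real_derivative
        real n * u ^ (n - 1) * - (u * u) * exp (- u) + u ^ n * (exp (- u) * (u * u))) (at t)"
      by (rule derivative_eq_intros inv refl)+ (simp add: u_def algebra_simps)
    moreover have "real n * u ^ (n - 1) * - (u * u) * exp (- u) + u ^ n * (exp (- u) * (u * u))
        = flat_exp (n + 2) t - real n * flat_exp (n + 1) t"
      using 3 by (cases n) (auto simp: flat_exp_def u_def[symmetric] exp_minus divide_inverse algebra_simps)
    ultimately have "((\<lambda>t. inverse t ^ n / exp (inverse t)) has_real_derivative
        flat_exp (n + 2) t - real n * flat_exp (n + 1) t) (at t)"
      by (simp only: exp_minus divide_inverse)
    then show ?thesis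
      by (rule has_field_derivative_transform_within_open[of _ _ _ "{0<..}"])
        (use 3 in \<open>auto simp: flat_exp_def\<close>)
  qed
qed

lemma smooth_on_flat_exp: "smooth_on UNIV (flat_exp n)"
proof -
  have "Ck_on k UNIV (flat_exp n)" for k
  proof (induction k arbitrary: n)
    case 0
    show ?case using DERIV_isCont[OF flat_exp_has_derivative]
      by (auto intro!: continuous_at_imp_continuous_on)
  next
    case (Suc k)
    show ?case
    proof (rule Ck_on_SucI)
      show "(flat_exp n has_derivative (\<lambda>v. (flat_exp (n + 2) t + (- real n) * flat_exp (n + 1) t) * v)) (at t)" for t
        using flat_exp_has_derivative[of n t] by (simp add: has_field_derivative_def)
      show "Ck_on k UNIV (\<lambda>t. (flat_exp (n + 2) t + (- real n) * flat_exp (n + 1) t) * v)" for v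
        by (intro Ck_on_bilinear[OF _ bounded_bilinear_mult] Ck_on_add Ck_on_const Suc.IH open_UNIV)
    qed auto
  qed
  then show ?thesis by (simp add: smooth_on_def)
qed

definition smooth_step :: "real \<Rightarrow> real" where
  "smooth_step t = flat_exp 0 t * inverse (flat_exp 0 t + flat_exp 0 (1 - t))"

lemma smooth_step_denominator: "0 < flat_exp 0 t + flat_exp 0 (1 - t)"
  by (cases "0 < t") (auto simp: flat_exp_nonneg flat_exp_pos_iff intro: add_pos_nonneg add_nonneg_pos)

lemma smooth_on_smooth_step: "smooth_on UNIV smooth_step"
  unfolding smooth_step_def[abs_def]
  by (intro smooth_on_mult smooth_on_inverse smooth_on_add smooth_on_flat_exp
      smooth_on_compose[OF _ _ smooth_on_flat_exp] smooth_on_diff smooth_on_const smooth_on_ident open_UNIV)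
    (use smooth_step_denominator less_numeral_extra(3) in \<open>auto simp: less_imp_neq[symmetric]\<close>)

lemma smooth_step_range: "0 \<le> smooth_step t" "smooth_step t \<le> 1"
  using smooth_step_denominator[of t] flat_exp_nonneg[of 0 t] flat_exp_nonneg[of 0 "1 - t"]
  by (auto simp: smooth_step_def field_simps)

lemma smooth_step_eq_0: "t \<le> 0 \<Longrightarrow> smooth_step t = 0"
  by (simp add: smooth_step_def flat_exp_def)

lemma smooth_step_eq_1: "1 \<le> t \<Longrightarrow> smooth_step t = 1"
  using smooth_step_denominator[of t] by (simp add: smooth_step_def flat_exp_def)

text \<open>A finite sum of bumps on balls inside \<open>V\<close> that cover \<open>K\<close> is positive on \<open>K\<close>. Dividing by its
  minimum on \<open>K\<close> and composing with the smooth step makes it equal to \<open>1\<close> there.\<close>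

lemma smooth_urysohn:
  fixes K :: "'a::euclidean_space set"
  assumes K: "compact K" and V: "open V" "K \<subseteq> V"
  obtains \<eta> C where "smooth_on UNIV \<eta>" "\<And>x. 0 \<le> \<eta> x" "\<And>x. \<eta> x \<le> (1::real)"
    "\<And>x. x \<in> K \<Longrightarrow> \<eta> x = 1" "compact C" "C \<subseteq> V" "\<And>x. x \<notin> C \<Longrightarrow> \<eta> x = 0"
proof -
  have "\<exists>r>0. cball x r \<subseteq> V" if "x \<in> K" for x
    using V that open_contains_cball by blast
  then obtain r where r: "\<And>x. x \<in> K \<Longrightarrow> 0 < r x" "\<And>x. x \<in> K \<Longrightarrow> cball x (r x) \<subseteq> V" by metis
  have "K \<subseteq> (\<Union>x\<in>K. ball x (r x))" using r by force
  then obtain D where D: "D \<subseteq> K" "finite D" "K \<subseteq> (\<Union>x\<in>D. ball x (r x))"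
    using compactE_image[OF K, of K "\<lambda>x. ball x (r x)"] by auto
  define f where "f = (\<lambda>y. \<Sum>x\<in>D. flat_exp 0 ((r x)^2 - (y - x) \<bullet> (y - x)))"
  define C where "C = (\<Union>x\<in>D. cball x (r x))"
  have f_smooth: "smooth_on UNIV f"
    unfolding f_def
    by (intro smooth_on_sum smooth_on_compose[OF _ _ smooth_on_flat_exp] smooth_on_diff smooth_on_inner
        smooth_on_const smooth_on_ident open_UNIV UNIV_I)
  have pos: "0 < flat_exp 0 ((r x)^2 - (y - x) \<bullet> (y - x)) \<longleftrightarrow> dist y x < r x" if "x \<in> D" for x y
  proof -
    have "0 < r x" using that D r by blast
    then show ?thesis
      by (simp add: flat_exp_pos_iff dot_square_norm dist_norm) (metis abs_le_square_iff abs_norm_cancel abs_of_pos not_le)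
  qed
  have f_pos: "0 < f y" if y: "y \<in> K" for y
  proof -
    obtain x where "x \<in> D" "dist y x < r x" using D y by (auto simp: dist_commute)
    then show ?thesis unfolding f_def
      using D(2) pos flat_exp_nonneg by (intro sum_pos2[of D x]) auto
  qed
  have f_zero: "f y = 0" if "y \<notin> C" for y
    unfolding f_def
  proof (intro sum.neutral ballI)
    fix x assume "x \<in> D"
    then show "flat_exp 0 ((r x)^2 - (y - x) \<bullet> (y - x)) = 0"
      using pos[of x y] that flat_exp_nonneg[of 0 "(r x)^2 - (y - x) \<bullet> (y - x)"]
      by (force simp: C_def dist_commute)
  qed
  obtain m where m: "0 < m" "\<And>y. y \<in> K \<Longrightarrow> m \<le> f y"
  proof (cases "K = {}")
    case False
    then obtain x where "x \<in> K" "\<And>y. y \<in> K \<Longrightarrow> f x \<le> f y"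
      using continuous_attains_inf[OF K False continuous_on_subset[OF smooth_on_imp_continuous_on[OF f_smooth]]]
      by auto
    then show ?thesis using f_pos that by blast
  qed (use that[of 1] in auto)
  show thesis
  proof
    show "smooth_on UNIV (\<lambda>x. smooth_step (f x * inverse m))"
      by (intro smooth_on_compose[OF _ _ smooth_on_smooth_step] smooth_on_mult f_smooth smooth_on_const
          open_UNIV UNIV_I)
    show "0 \<le> smooth_step (f x * inverse m)" "smooth_step (f x * inverse m) \<le> 1" for x
      by (rule smooth_step_range)+
    show "smooth_step (f x * inverse m) = 1" if "x \<in> K" for x
      using m that by (intro smooth_step_eq_1) (simp add: field_simps)
    show "compact C" unfolding C_def using D by (intro compact_UN) auto
    show "C \<subseteq> V" unfolding C_def using D r by blast
    show "smooth_step (f x * inverse m) = 0" if "x \<notin> C" for x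
      using f_zero[OF that] by (simp add: smooth_step_eq_0)
  qed
qed

text \<open>The majorant is a locally finite sum: the \<open>n\<close>-th term vanishes on the \<open>n\<close>-th set of a compact
  exhaustion and is as large as needed outside the next one.\<close>

lemma smooth_majorant:
  fixes U :: "'a::euclidean_space set" and h :: "'a \<Rightarrow> real"
  assumes U: "open U"
    and loc: "\<And>c. c \<in> U \<Longrightarrow> \<exists>N B. open N \<and> c \<in> N \<and> (\<forall>x\<in>N \<inter> U. h x \<le> B)"
  obtains r where "smooth_on U r" "\<And>x. x \<in> U \<Longrightarrow> h x < r x" "\<And>x. x \<in> U \<Longrightarrow> 0 < r x"
proof -
  obtain C where C: "\<And>n. compact (C n)" "\<And>n. C n \<subseteq> U" "\<And>n. C n \<subseteq> interior (C (Suc n))" "\<Union> (range C) = U"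
    using open_Union_compact_subsets[OF U] by metis
  have mono: "C m \<subseteq> C n" if "m \<le> n" for m n
    by (rule lift_Suc_mono_le[of C, OF _ that]) (use C(3) interior_subset in blast)
  have "\<exists>B\<ge>0. \<forall>x\<in>C n. h x \<le> B" for n
  proof -
    obtain N B where N: "\<And>c. c \<in> U \<Longrightarrow> open (N c)" "\<And>c. c \<in> U \<Longrightarrow> c \<in> N c"
      "\<And>c x. c \<in> U \<Longrightarrow> x \<in> N c \<inter> U \<Longrightarrow> h x \<le> B c"
      using loc by metis
    obtain D where D: "D \<subseteq> C n" "finite D" "C n \<subseteq> (\<Union>c\<in>D. N c)"
    proof (rule compactE_image[OF C(1), of "C n" N])
      show "open (N c)" if "c \<in> C n" for c using that N(1) C(2) by blast
      show "C n \<subseteq> (\<Union>c\<in>C n. N c)" using N(2) C(2) by blast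
    qed
    have "h x \<le> (\<Sum>c\<in>D. \<bar>B c\<bar>)" if x: "x \<in> C n" for x
    proof -
      obtain c where c: "c \<in> D" "x \<in> N c" using D x by blast
      then have "h x \<le> \<bar>B c\<bar>" using N(3)[of c x] D C(2) x by force
      also have "\<dots> \<le> (\<Sum>c\<in>D. \<bar>B c\<bar>)" using c D by (intro member_le_sum) auto
      finally show ?thesis .
    qed
    then show ?thesis by (intro exI[of _ "\<Sum>c\<in>D. \<bar>B c\<bar>"]) (auto intro: sum_nonneg)
  qed
  then obtain B where B: "\<And>n. 0 \<le> B n" "\<And>n x. x \<in> C n \<Longrightarrow> h x \<le> B n" by metis
  have "\<exists>\<eta>. smooth_on UNIV \<eta> \<and> (\<forall>x. 0 \<le> \<eta> x \<and> \<eta> x \<le> 1) \<and> (\<forall>x\<in>C n. \<eta> x = 1) \<and> (\<forall>x. x \<notin> C (Suc n) \<longrightarrow> \<eta> x = (0::real))" for n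
  proof -
    obtain \<eta> D where "smooth_on UNIV \<eta>" "\<And>x. 0 \<le> \<eta> x" "\<And>x. \<eta> x \<le> (1::real)" "\<And>x. x \<in> C n \<Longrightarrow> \<eta> x = 1"
      "compact D" "D \<subseteq> interior (C (Suc n))" "\<And>x. x \<notin> D \<Longrightarrow> \<eta> x = 0"
      using smooth_urysohn[OF C(1) open_interior C(3), of n] by blast
    then show ?thesis using interior_subset by (intro exI[of _ \<eta>]) blast
  qed
  then obtain \<eta> where \<eta>: "\<And>n. smooth_on UNIV (\<eta> n)" "\<And>n x. \<eta> n x \<le> (1::real)"
    "\<And>n x. x \<in> C n \<Longrightarrow> \<eta> n x = 1" "\<And>n x. x \<notin> C (Suc n) \<Longrightarrow> \<eta> n x = 0" by metis
  \<comment> \<open>\<open>\<eta> n\<close> is only known to vanish off \<open>C (n + 1)\<close>, so a point that first lies in \<open>C (n + 2)\<close> must be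
    served by the \<open>n\<close>-th term; the constants \<open>B 0\<close> and \<open>B 1\<close> take care of \<open>C 1\<close>\<close>
  define s where "s = (\<lambda>x n. (1 - \<eta> n x) * B (Suc (Suc n)))"
  define r where "r = (\<lambda>x. 1 + B 0 + B 1 + (\<Sum>n | x \<notin> C n. s x n))"
  have s_nonneg: "0 \<le> s x n" for x n using \<eta>(2) B(1) by (simp add: s_def)
  have r_eq: "r x = 1 + B 0 + B 1 + (\<Sum>n<N. s x n)" and fin: "finite {n. x \<notin> C n}" if x: "x \<in> C N" for x N
  proof -
    have sub: "{n. x \<notin> C n} \<subseteq> {..<N}" using mono x by (force simp: not_le[symmetric])
    then show "finite {n. x \<notin> C n}" using finite_subset by blast
    have "(\<Sum>n | x \<notin> C n. s x n) = (\<Sum>n<N. s x n)"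
      by (rule sum.mono_neutral_left[OF _ sub]) (auto simp: s_def \<eta>(3))
    then show "r x = 1 + B 0 + B 1 + (\<Sum>n<N. s x n)" by (simp add: r_def)
  qed
  show thesis
  proof
    show "smooth_on U r"
    proof (rule smooth_on_local[OF U])
      fix x assume "x \<in> U"
      then obtain n where "x \<in> C n" using C(4) by blast
      then have x: "x \<in> interior (C (Suc n))" using C(3) by blast
      have "smooth_on (interior (C (Suc n))) (\<lambda>x. 1 + B 0 + B 1 + (\<Sum>n<Suc n. s x n))"
        unfolding s_def using \<eta>(1)
        by (intro smooth_intros open_interior) (auto intro: smooth_on_subset)
      then have "smooth_on (interior (C (Suc n))) r"
        by (rule smooth_on_cong[OF open_interior, rotated]) (use r_eq interior_subset in \<open>metis subsetD\<close>)
      then show "\<exists>W. open W \<and> x \<in> W \<and> smooth_on W r" using x open_interior by blast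
    qed
    fix x assume "x \<in> U"
    then obtain N where N: "x \<in> C N" using C(4) by blast
    have sum_nn: "0 \<le> (\<Sum>n | x \<notin> C n. s x n)" by (intro sum_nonneg) (rule s_nonneg)
    then show "0 < r x" using B(1)[of 0] B(1)[of 1] by (simp add: r_def)
    show "h x < r x"
    proof (cases "x \<in> C 1")
      case True
      then show ?thesis using B(2)[OF True] B(1)[of 0] sum_nn by (simp add: r_def)
    next
      case False
      define m where "m = (LEAST n. x \<in> C n)"
      have m: "x \<in> C m" "\<And>n. n < m \<Longrightarrow> x \<notin> C n"
        using N not_less_Least unfolding m_def by (auto intro: LeastI)
      have "m \<noteq> 0" "m \<noteq> 1" using m(1) False mono[of 0 1] by (metis subsetD zero_le_one, metis)
      then obtain n where n: "m = Suc (Suc n)" by (metis One_nat_def old.nat.exhaust)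
      have "s x n = B m" using m(2)[of "Suc n"] \<eta>(4)[of x n] by (simp add: s_def n)
      moreover have "s x n \<le> (\<Sum>n | x \<notin> C n. s x n)"
        using m(2)[of n] fin[OF N] s_nonneg n by (intro member_le_sum) auto
      ultimately have "h x \<le> (\<Sum>n | x \<notin> C n. s x n)" using B(2)[OF m(1)] by simp
      then show ?thesis using B(1)[of 0] B(1)[of 1] by (simp add: r_def)
    qed
  qed
qed

text \<open>The cut off field has compact support, so its derivative is bounded, which makes it Lipschitz.\<close>

lemma smooth_cutoff_field:
  fixes V :: "'a::euclidean_space \<Rightarrow> 'b::real_normed_vector"
  assumes \<Omega>: "open \<Omega>" and V: "smooth_on \<Omega> V" and \<eta>: "smooth_on UNIV \<eta>"
    and C: "compact C" "C \<subseteq> \<Omega>" "\<And>x. x \<notin> C \<Longrightarrow> \<eta> x = 0"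
  defines "X \<equiv> \<lambda>x. if x \<in> \<Omega> then \<eta> x *\<^sub>R V x else 0"
  shows "smooth_on UNIV X" "\<exists>L>0. \<forall>u v. norm (X u - X v) \<le> L * norm (u - v)"
proof -
  have oC: "open (- C)" using C(1) compact_imp_closed by blast
  have X0: "X x = 0" if "x \<in> - C" for x using that C by (simp add: X_def)
  show X: "smooth_on UNIV X"
  proof (rule smooth_on_local[OF open_UNIV])
    fix x
    show "\<exists>W. open W \<and> x \<in> W \<and> smooth_on W X"
    proof (cases "x \<in> C")
      case True
      have "smooth_on \<Omega> X"
        by (rule smooth_on_cong[OF \<Omega> _ smooth_on_scaleR[OF \<Omega> smooth_on_subset[OF \<eta>] V]]) (auto simp: X_def)
      then show ?thesis using \<Omega> C True by blast
    next
      case False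
      have "smooth_on (- C) X"
        by (rule smooth_on_cong[OF oC _ smooth_on_const[of _ 0]]) (simp add: X0)
      then show ?thesis using oC False by blast
    qed
  qed
  define D where "D = (\<lambda>x. frechet_derivative X (at x))"
  have D: "(X has_derivative D x) (at x)" for x
    unfolding D_def by (rule smooth_on_has_derivative[OF X UNIV_I])
  have "\<exists>B. \<forall>x. norm (D x b) \<le> B" for b
  proof -
    have "continuous_on UNIV (\<lambda>x. D x b)"
      unfolding D_def by (rule smooth_on_imp_continuous_on[OF smooth_on_frechet_derivative[OF X]])
    then have "bounded ((\<lambda>x. D x b) ` C)"
      by (intro compact_imp_bounded compact_continuous_image C(1)) (rule continuous_on_subset, auto)
    then obtain B where B: "\<forall>x\<in>C. norm (D x b) \<le> B" by (auto simp: bounded_iff)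
    have "norm (D x b) \<le> \<bar>B\<bar>" for x
    proof (cases "x \<in> C")
      case False
      have "((\<lambda>_. 0) has_derivative D x) (at x)"
        by (rule has_derivative_transform_within_open[OF D oC]) (use False X0 in auto)
      then have "D x = (\<lambda>_. 0)" using has_derivative_unique has_derivative_const by blast
      then show ?thesis by simp
    qed (use B in force)
    then show ?thesis by blast
  qed
  then obtain B where B: "\<And>b x. norm (D x b) \<le> B b" by metis
  define L where "L = 1 + (\<Sum>b\<in>Basis. B b)"
  have Bn: "0 \<le> B b" for b using B norm_ge_zero order_trans by blast
  then have L: "0 < L" by (simp add: L_def add_pos_nonneg sum_nonneg)
  have "norm (D x v) \<le> L * norm v" for x v
  proof -
    have "norm (D x v) \<le> (\<Sum>b\<in>Basis. norm ((v \<bullet> b) *\<^sub>R D x b))"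
      using linear_basis_expansion[OF has_derivative_linear[OF D], of x v] norm_sum by metis
    also have "\<dots> \<le> (\<Sum>b\<in>Basis. norm v * B b)"
      using B Basis_le_norm by (intro sum_mono) (auto intro!: mult_mono)
    also have "\<dots> \<le> L * norm v" by (simp add: L_def algebra_simps sum_distrib_left)
    finally show ?thesis .
  qed
  then have "onorm (D x) \<le> L" for x by (intro onorm_bound) (use L in auto)
  then have "norm (X u - X v) \<le> L * norm (u - v)" for u v
    by (intro differentiable_bound[OF convex_UNIV D]) auto
  then show "\<exists>L>0. \<forall>u v. norm (X u - X v) \<le> L * norm (u - v)" using L by blast
qed

section \<open>Transport between level sets\<close>

text \<open>The radius beyond which the field is tangent to the spheres may grow without bound as the values
  approach the ends of \<open>U\<close>, where asymptotic values are possible.\<close>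

locale level_field =
  fixes g :: "'a::euclidean_space \<Rightarrow> real" and U :: "real set" and V :: "'a \<Rightarrow> 'a"
  assumes g: "smooth_on UNIV g" and U: "open U" "is_interval U"
    and V: "smooth_on (g -` U) V"
    and unit_speed: "\<And>x. g x \<in> U \<Longrightarrow> frechet_derivative g (at x) (V x) = 1"
    and tangent: "\<And>J. compact J \<Longrightarrow> J \<subseteq> U \<Longrightarrow> \<exists>R. \<forall>x. g x \<in> J \<and> R < norm x \<longrightarrow> V x \<bullet> x = 0"
begin

lemma g_continuous: "continuous_on S g"
  using smooth_on_imp_continuous_on[OF g] continuous_on_subset by blast

lemma open_preimage: "open W \<Longrightarrow> open (g -` W)"
  using g_continuous continuous_on_open_vimage[of UNIV g] by simp

lemma open_domain: "open (g -` U)"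
  by (rule open_preimage[OF U(1)])

lemma derivative_along_curve:
  assumes "(y has_vector_derivative w) (at t)"
  shows "((\<lambda>t. g (y t)) has_real_derivative frechet_derivative g (at (y t)) w) (at t)"
proof -
  have D: "(g has_derivative frechet_derivative g (at (y t))) (at (y t))"
    by (rule smooth_on_has_derivative[OF g UNIV_I])
  show ?thesis
    using has_derivative_compose[OF assms[unfolded has_vector_derivative_def] D]
    by (simp add: has_field_derivative_def linear_scale[OF has_derivative_linear[OF D]] mult_commute_abs)
qed

text \<open>The curves of the cut off field \<open>X = \<eta> V\<close> are controlled in three steps. Along them \<open>g\<close> grows at a
  speed between \<open>0\<close> and \<open>1\<close>, whether or not they meet the region where \<open>\<eta> = 1\<close>; so their values stay
  in \<open>{a..b}\<close> for the times considered. Therefore \<open>X\<close> is tangent to the spheres wherever they are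
  outside the ball of radius \<open>M\<close>, and they stay in this ball. So they stay in \<open>N\<close>, where \<open>X = V\<close>.\<close>

lemma transport_box:
  assumes ab: "{a..b} \<subseteq> U"
  obtains \<psi> where "smooth_on UNIV \<psi>"
    "\<And>x. g x \<in> {a..b} \<Longrightarrow> norm x \<le> R \<Longrightarrow> \<psi> (g x, x) = x"
    "\<And>x s. g x \<in> {a..b} \<Longrightarrow> norm x \<le> R \<Longrightarrow> s \<in> {a..b} \<Longrightarrow> g (\<psi> (s, x)) = s"
    "\<And>x s. g x \<in> {a..b} \<Longrightarrow> norm x \<le> R \<Longrightarrow> s \<in> {a..b} \<Longrightarrow>
        ((\<lambda>s. \<psi> (s, x)) has_vector_derivative V (\<psi> (s, x))) (at s)"
proof -
  obtain R0 where R0: "\<And>x. g x \<in> {a..b} \<Longrightarrow> R0 < norm x \<Longrightarrow> V x \<bullet> x = 0"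
    using tangent[OF compact_Icc ab] by blast
  define M where "M = max 0 (max R R0)"
  define N where "N = g -` {a..b} \<inter> cball 0 M"
  have "compact N"
    unfolding N_def by (intro closed_Int_compact closed_vimage g_continuous) auto
  moreover have "N \<subseteq> g -` U" using ab by (auto simp: N_def)
  ultimately obtain \<eta> C where \<eta>: "smooth_on UNIV \<eta>" "\<And>x. 0 \<le> \<eta> x" "\<And>x. \<eta> x \<le> (1::real)"
    "\<And>x. x \<in> N \<Longrightarrow> \<eta> x = 1" and C: "compact C" "C \<subseteq> g -` U" "\<And>x. x \<notin> C \<Longrightarrow> \<eta> x = 0"
    using smooth_urysohn[OF _ open_domain, of N] by blast
  define X where "X = (\<lambda>x. if x \<in> g -` U then \<eta> x *\<^sub>R V x else 0)"
  obtain L where "smooth_on UNIV X" "0 < L" "\<And>u v. norm (X u - X v) \<le> L * norm (u - v)"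
    using smooth_cutoff_field[OF open_domain V \<eta>(1) C] unfolding X_def by blast
  then obtain \<phi> where \<phi>: "smooth_on UNIV \<phi>" "\<And>x. \<phi> (0, x) = x"
    "\<And>t x. ((\<lambda>t. \<phi> (t, x)) has_vector_derivative X (\<phi> (t, x))) (at t)"
    using smooth_flow_exists by metis
  have main: "g (\<phi> (t, x)) = g x + t \<and> \<phi> (t, x) \<in> N"
    if x: "g x \<in> {a..b}" "norm x \<le> R" and t: "g x + t \<in> {a..b}" for x t
  proof -
    define y where "y = (\<lambda>t. \<phi> (t, x))"
    define I where "I = {a - g x..b - g x}"
    have y0: "y 0 = x" by (simp add: y_def \<phi>)
    have y: "(y has_vector_derivative X (y t)) (at t)" for t unfolding y_def by (rule \<phi>)
    define e where "e = (\<lambda>t. frechet_derivative g (at (y t)) (X (y t)))"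
    have Dg: "((\<lambda>t. g (y t)) has_real_derivative e t) (at t)" for t
      unfolding e_def by (rule derivative_along_curve[OF y])
    have e: "e t = (if y t \<in> g -` U then \<eta> (y t) else 0)" for t
      using unit_speed[of "y t"]
        linear_scale[OF has_derivative_linear[OF smooth_on_has_derivative[OF g UNIV_I]], of "y t" "\<eta> (y t)" "V (y t)"]
        linear_0[OF has_derivative_linear[OF smooth_on_has_derivative[OF g UNIV_I]], of "y t"]
      by (simp add: e_def X_def)
    have e01: "0 \<le> e t" "e t \<le> 1" for t using e \<eta>(2,3) by auto
    have up: "g (y s) \<le> g (y t)" if "s \<le> t" for s t
      using DERIV_nonneg_imp_nondecreasing[OF that, of "\<lambda>t. g (y t)"] Dg e01 by blast
    have slow: "g (y t) - t \<le> g (y s) - s" if "s \<le> t" for s t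
    proof (rule DERIV_nonpos_imp_nonincreasing[OF that])
      fix u
      have "((\<lambda>t. g (y t) - t) has_real_derivative e u - 1) (at u)"
        by (rule derivative_eq_intros Dg refl)+
      then show "\<exists>y'. ((\<lambda>t. g (y t) - t) has_real_derivative y') (at u) \<and> y' \<le> 0"
        using e01(2)[of u] by (intro exI[of _ "e u - 1"]) simp
    qed
    have vals: "g (y t) \<in> {a..b}" if "t \<in> I" for t
    proof (cases "0 \<le> t")
      case True
      show ?thesis using up[OF True] slow[OF True] that x by (auto simp: I_def y0)
    next
      case False
      then have "t \<le> 0" by simp
      show ?thesis using up[OF \<open>t \<le> 0\<close>] slow[OF \<open>t \<le> 0\<close>] that x by (auto simp: I_def y0)
    qed
    have I0: "0 \<in> I" and It: "t \<in> I" using x t by (auto simp: I_def)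
    \<comment> \<open>\<open>q\<close> measures by how much \<open>y\<close> is outside the ball; being flat at its zeros it is differentiable
      and has derivative \<open>0\<close> inside the ball as well as outside\<close>
    define q where "q = (\<lambda>t. flat_exp 0 (y t \<bullet> y t - M^2))"
    have sq: "y t \<bullet> y t - M^2 \<le> 0 \<longleftrightarrow> norm (y t) \<le> M" for t
    proof -
      have "y t \<bullet> y t - M^2 \<le> 0 \<longleftrightarrow> (norm (y t))^2 \<le> M^2" by (simp add: dot_square_norm)
      also have "\<dots> \<longleftrightarrow> norm (y t) \<le> M" by (simp add: M_def flip: abs_le_square_iff)
      finally show ?thesis .
    qed
    have "(q has_real_derivative 0) (at t within I)" if "t \<in> I" for t
    proof -
      have "((\<lambda>t. y t \<bullet> y t - M^2) has_real_derivative 2 * (X (y t) \<bullet> y t)) (at t)"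
        unfolding has_field_derivative_def
        by (rule has_derivative_eq_rhs[OF has_derivative_diff[OF has_derivative_inner[OF
                y[unfolded has_vector_derivative_def] y[unfolded has_vector_derivative_def]] has_derivative_const]])
          (auto simp: inner_commute algebra_simps)
      from DERIV_chain2[OF flat_exp_has_derivative[of 0] this]
      have "(q has_real_derivative (flat_exp 2 (y t \<bullet> y t - M^2)) * (2 * (X (y t) \<bullet> y t))) (at t)"
        unfolding q_def by (simp add: numeral_2_eq_2)
      moreover have "flat_exp 2 (y t \<bullet> y t - M^2) * (2 * (X (y t) \<bullet> y t)) = 0"
      proof (cases "norm (y t) \<le> M")
        case True
        then show ?thesis using sq[of t] by (simp add: flat_exp_def)
      next
        case False
        then have "V (y t) \<bullet> y t = 0" using vals[OF that] by (intro R0) (auto simp: M_def)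
        then show ?thesis by (simp add: X_def)
      qed
      ultimately show ?thesis using has_field_derivative_at_within by metis
    qed
    then obtain c where "\<forall>t\<in>I. q t = c"
      using has_field_derivative_zero_constant[of I q] by (auto simp: I_def)
    then have "q t = q 0" if "t \<in> I" for t using that I0 by metis
    moreover have "q 0 = 0"
      using sq[of 0] x by (simp add: q_def flat_exp_def y0 M_def)
    ultimately have "norm (y t) \<le> M" if "t \<in> I" for t
      using sq[of t] flat_exp_pos_iff[of 0 "y t \<bullet> y t - M^2"] that by (force simp: q_def)
    then have N: "y t \<in> N" if "t \<in> I" for t using vals[OF that] that by (simp add: N_def)
    have "((\<lambda>t. g (y t) - t) has_real_derivative 0) (at t within I)" if "t \<in> I" for t
    proof -
      have "e t = 1" using e[of t] \<eta>(4)[OF N[OF that]] N[OF that] ab by (auto simp: N_def)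
      then have "((\<lambda>t. g (y t) - t) has_real_derivative 0) (at t)"
        using DERIV_diff[OF Dg[of t] DERIV_ident] by simp
      then show ?thesis using has_field_derivative_at_within by blast
    qed
    then obtain c where "\<forall>t\<in>I. g (y t) - t = c"
      using has_field_derivative_zero_constant[of I "\<lambda>t. g (y t) - t"] by (auto simp: I_def)
    then have "g (y t) - t = g (y 0) - 0" using I0 It by metis
    then show ?thesis using N[OF It] y0 by (simp add: y_def)
  qed
  show thesis
  proof
    define \<psi> where "\<psi> = (\<lambda>sx. \<phi> (fst sx - g (snd sx), snd sx))"
    show "smooth_on UNIV \<psi>"
      unfolding \<psi>_def
      by (intro smooth_on_compose[OF open_UNIV open_UNIV \<phi>(1)] smooth_on_Pair smooth_on_diff
          smooth_on_compose[OF open_UNIV open_UNIV g] smooth_on_fst smooth_on_snd smooth_on_ident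
          open_UNIV UNIV_I)
    fix x assume x: "g x \<in> {a..b}" "norm x \<le> R"
    show "\<psi> (g x, x) = x" by (simp add: \<psi>_def \<phi>)
    fix s assume s: "s \<in> {a..b}"
    have m: "g (\<phi> (s - g x, x)) = s" "\<phi> (s - g x, x) \<in> N" using main[OF x, of "s - g x"] s by auto
    show "g (\<psi> (s, x)) = s" using m by (simp add: \<psi>_def)
    have "X (\<phi> (s - g x, x)) = V (\<phi> (s - g x, x))"
      using \<eta>(4)[OF m(2)] m(1) s ab by (auto simp: X_def)
    then show "((\<lambda>s. \<psi> (s, x)) has_vector_derivative V (\<psi> (s, x))) (at s)"
      using has_vector_derivative_comp_affine[of "\<lambda>t. \<phi> (t, x)" _ "- g x" 1 s] \<phi>(3)[where x=x and t="s - g x"]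
      by (simp add: \<psi>_def)
  qed
qed

text \<open>The curve is parametrized by the values of \<open>g\<close>, and is only required to follow \<open>V\<close> on the segment
  between the two values; the flows of the different cut off fields all provide such curves.\<close>

definition lifts :: "'a \<Rightarrow> real \<Rightarrow> (real \<Rightarrow> 'a) \<Rightarrow> bool" where
  "lifts x t y \<longleftrightarrow> y (g x) = x \<and> (\<forall>s\<in>closed_segment (g x) t.
     g (y s) = s \<and> (y has_vector_derivative V (y s)) (at s))"

definition transport :: "real \<times> 'a \<Rightarrow> 'a" where
  "transport tx = (THE z. \<exists>y. lifts (snd tx) (fst tx) y \<and> y (fst tx) = z)"

lemma segment_in_U: "c \<in> U \<Longrightarrow> t \<in> U \<Longrightarrow> closed_segment c t \<subseteq> U"
  using U(2) by (simp add: closed_segment_subset is_interval_convex)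

text \<open>Two curves over a compact segment stay in a compact subset of the domain, so they are integral
  curves of one globally Lipschitz field.\<close>

lemma lifts_unique:
  assumes "g x \<in> U" "t \<in> U" and y: "lifts x t y" and z: "lifts x t z"
  shows "y t = z t"
proof -
  define S where "S = closed_segment (g x) t"
  define K where "K = y ` S \<union> z ` S"
  have "S \<subseteq> U" unfolding S_def using segment_in_U assms by blast
  have cont: "continuous_on S w" if "lifts x t w" for w
  proof (intro continuous_at_imp_continuous_on ballI)
    fix s assume "s \<in> S"
    then show "isCont w s"
      using that by (intro has_vector_derivative_continuous[of w "V (w s)"]) (auto simp: lifts_def S_def)
  qed
  have "compact K" unfolding K_def
    by (intro compact_Un compact_continuous_image cont y z) (auto simp: S_def)
  moreover have "K \<subseteq> g -` U"
    using y z \<open>S \<subseteq> U\<close> by (auto simp: K_def lifts_def S_def)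
  ultimately obtain \<eta> C where \<eta>: "smooth_on UNIV \<eta>" "\<And>x. 0 \<le> \<eta> x" "\<And>x. \<eta> x \<le> (1::real)"
    "\<And>x. x \<in> K \<Longrightarrow> \<eta> x = 1" and C: "compact C" "C \<subseteq> g -` U" "\<And>x. x \<notin> C \<Longrightarrow> \<eta> x = 0"
    using smooth_urysohn[OF _ open_domain, of K] by blast
  define X where "X = (\<lambda>x. if x \<in> g -` U then \<eta> x *\<^sub>R V x else 0)"
  obtain L where L: "0 < L" "\<And>u v. norm (X u - X v) \<le> L * norm (u - v)"
    using smooth_cutoff_field(2)[OF open_domain V \<eta>(1) C] unfolding X_def by blast
  have XV: "X p = V p" if "p \<in> K" for p
    using that \<open>K \<subseteq> g -` U\<close> \<eta>(4) by (auto simp: X_def)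
  show ?thesis
  proof (rule ivp_unique[where c="g x" and f="\<lambda>_. X" and L=L])
    show "(y has_vector_derivative X (y s)) (at s)" "(z has_vector_derivative X (z s)) (at s)"
      if "s \<in> closed_segment (g x) t" for s
      using that y z XV[of "y s"] XV[of "z s"] by (auto simp: lifts_def K_def S_def)
    show "y (g x) = z (g x)" using y z by (simp add: lifts_def)
  qed (use L in auto)
qed

lemma transport_eqI:
  assumes "g x \<in> U" "t \<in> U" "lifts x t y"
  shows "transport (t, x) = y t"
  unfolding transport_def
proof (rule the_equality)
  show "\<exists>y'. lifts (snd (t, x)) (fst (t, x)) y' \<and> y' (fst (t, x)) = y t" using assms by auto
  show "z = y t" if "\<exists>y. lifts (snd (t, x)) (fst (t, x)) y \<and> y (fst (t, x)) = z" for z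
    using that assms lifts_unique by auto
qed

text \<open>One curve through \<open>x\<close> over a common interval of values serves for all transports.\<close>

lemma curve_over_interval:
  assumes "{a..b} \<subseteq> U" "g x \<in> {a..b}"
  obtains y where "\<And>t. t \<in> {a..b} \<Longrightarrow> g (y t) = t"
    "\<And>s t. s \<in> {a..b} \<Longrightarrow> t \<in> {a..b} \<Longrightarrow> transport (t, y s) = y t" "y (g x) = x"
proof -
  obtain \<psi> where \<psi>: "\<psi> (g x, x) = x" "\<And>s. s \<in> {a..b} \<Longrightarrow> g (\<psi> (s, x)) = s"
    "\<And>s. s \<in> {a..b} \<Longrightarrow> ((\<lambda>s. \<psi> (s, x)) has_vector_derivative V (\<psi> (s, x))) (at s)"
    using transport_box[OF assms(1), of "norm x"] assms(2) by (metis order_refl)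
  show thesis
  proof
    fix s t assume st: "s \<in> {a..b}" "t \<in> {a..b}"
    then have "closed_segment s t \<subseteq> {a..b}" by (intro closed_segment_subset) auto
    then have "lifts (\<psi> (s, x)) t (\<lambda>t. \<psi> (t, x))" using \<psi> st by (auto simp: lifts_def)
    then show "transport (t, \<psi> (s, x)) = \<psi> (t, x)"
      using st \<psi>(2) assms(1) by (intro transport_eqI) auto
  qed (use \<psi> in auto)
qed

lemma Icc_in_U: "c \<in> U \<Longrightarrow> d \<in> U \<Longrightarrow> {c..d} \<subseteq> U"
  by (rule subsetI) (metis U(2) atLeastAtMost_iff mem_is_interval_1_I)

lemma interval_around:
  assumes "c \<in> U" "t \<in> U"
  obtains a b where "{a..b} \<subseteq> U" "a < c" "c < b" "a < t" "t < b"
proof -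
  have "min c t \<in> U" "max c t \<in> U" using assms by (auto simp: min_def max_def)
  then obtain d e where de: "0 < d" "cball (min c t) d \<subseteq> U" "0 < e" "cball (max c t) e \<subseteq> U"
    using U(1) open_contains_cball by metis
  have "min c t - d \<in> U" "max c t + e \<in> U" using de by (auto simp: subset_iff dist_real_def)
  then have "{min c t - d..max c t + e} \<subseteq> U" by (rule Icc_in_U)
  then show thesis using de by (intro that) auto
qed

lemma transport_props:
  assumes "g x \<in> U" "s \<in> U" "t \<in> U"
  shows "g (transport (t, x)) = t" "transport (g x, x) = x"
    "transport (s, transport (t, x)) = transport (s, x)"
proof -
  define a b where "a = min (g x) (min s t)" and "b = max (g x) (max s t)"
  have "a \<in> U" "b \<in> U" using assms by (simp_all add: a_def b_def min_def max_def)
  then have ab: "{a..b} \<subseteq> U" by (rule Icc_in_U)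
  have mem: "g x \<in> {a..b}" "s \<in> {a..b}" "t \<in> {a..b}" by (auto simp: a_def b_def)
  obtain y where y: "\<And>t. t \<in> {a..b} \<Longrightarrow> g (y t) = t"
    "\<And>s t. s \<in> {a..b} \<Longrightarrow> t \<in> {a..b} \<Longrightarrow> transport (t, y s) = y t" "y (g x) = x"
    using curve_over_interval[OF ab mem(1)] by blast
  have eq: "transport (r, x) = y r" if "r \<in> {a..b}" for r using y(2)[OF mem(1) that] y(3) by simp
  show "g (transport (t, x)) = t" using eq y(1) mem by simp
  show "transport (g x, x) = x" using eq y(3) mem by simp
  show "transport (s, transport (t, x)) = transport (s, x)" using eq y(2) mem by simp
qed

text \<open>Near a given point transport is given by a single box, hence by the flow of a single field.\<close>

lemma transport_smooth: "smooth_on (U \<times> g -` U) transport"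
proof (rule smooth_on_local)
  show "open (U \<times> g -` U)" by (intro open_Times U open_domain)
  fix tx assume "tx \<in> U \<times> g -` U"
  then obtain t x where tx: "tx = (t, x)" "t \<in> U" "g x \<in> U" by auto
  obtain a b where ab: "{a..b} \<subseteq> U" "a < g x" "g x < b" "a < t" "t < b"
    by (rule interval_around[OF tx(3,2)])
  define R where "R = norm x + 1"
  obtain \<psi> where \<psi>: "smooth_on UNIV \<psi>" "\<And>x. g x \<in> {a..b} \<Longrightarrow> norm x \<le> R \<Longrightarrow> \<psi> (g x, x) = x"
    "\<And>x s. g x \<in> {a..b} \<Longrightarrow> norm x \<le> R \<Longrightarrow> s \<in> {a..b} \<Longrightarrow> g (\<psi> (s, x)) = s"
    "\<And>x s. g x \<in> {a..b} \<Longrightarrow> norm x \<le> R \<Longrightarrow> s \<in> {a..b} \<Longrightarrow>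
        ((\<lambda>s. \<psi> (s, x)) has_vector_derivative V (\<psi> (s, x))) (at s)"
    using transport_box[OF ab(1), of R] by blast
  define W where "W = {a<..<b} \<times> (g -` {a<..<b} \<inter> ball 0 R)"
  have "open W" unfolding W_def by (intro open_Times open_Int open_preimage) auto
  moreover have "tx \<in> W" using tx ab by (simp add: W_def R_def)
  moreover have "smooth_on W transport"
  proof (rule smooth_on_cong[OF \<open>open W\<close> _ smooth_on_subset[OF \<psi>(1)]])
    fix sz assume "sz \<in> W"
    then obtain s z where sz: "sz = (s, z)" "s \<in> {a..b}" "g z \<in> {a..b}" "norm z \<le> R"
      by (auto simp: W_def)
    have "closed_segment (g z) s \<subseteq> {a..b}" using sz by (intro closed_segment_subset) auto
    then have "lifts z s (\<lambda>s. \<psi> (s, z))" using \<psi> sz by (auto simp: lifts_def)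
    then show "\<psi> sz = transport sz" using transport_eqI[of z s] sz subsetD[OF ab(1) sz(2)] subsetD[OF ab(1) sz(3)] by simp
  qed auto
  ultimately show "\<exists>W. open W \<and> tx \<in> W \<and> smooth_on W transport" by blast
qed

end

section \<open>A field tangent to spheres at infinity\<close>

lemma smooth_gradient:
  assumes "smooth_on UNIV g"
  shows "smooth_on UNIV (grad g)" "frechet_derivative g (at x) v = grad g x \<bullet> v"
proof -
  define D where "D = (\<lambda>x. \<Sum>b\<in>Basis. frechet_derivative g (at x) b *\<^sub>R b)"
  have gd: "(g has_derivative frechet_derivative g (at x)) (at x)" for x
    by (rule smooth_on_has_derivative[OF assms UNIV_I])
  have eq: "frechet_derivative g (at x) v = v \<bullet> D x" for x v
    using linear_basis_expansion[OF has_derivative_linear[OF gd], of x v]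
    by (simp add: D_def inner_sum_right mult.commute)
  have "GDERIV g x :> D x" for x
    using gd[of x] unfolding gderiv_def eq[abs_def] .
  then have "grad g = D" by (auto intro: grad_eqI)
  moreover have "smooth_on UNIV D"
    unfolding D_def
    by (intro smooth_on_sum smooth_on_scaleR smooth_on_const smooth_on_frechet_derivative assms open_UNIV)
  ultimately show "smooth_on UNIV (grad g)" "frechet_derivative g (at x) v = grad g x \<bullet> v"
    by (auto simp: eq inner_commute)
qed

text \<open>Otherwise points of the radial set with values in ever smaller neighbourhoods of \<open>c\<close> and ever larger
  norm would show that \<open>c\<close> is an asymptotic value.\<close>

lemma radial_set_locally_bounded:
  assumes "c \<notin> asymp_values g"
  shows "\<exists>d>0. \<exists>B. \<forall>x\<in>radial_set g. \<bar>g x - c\<bar> < d \<longrightarrow> norm x \<le> B"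
proof (rule ccontr)
  assume neg: "\<not> ?thesis"
  have "\<exists>x\<in>radial_set g. \<bar>g x - c\<bar> < inverse (real (Suc n)) \<and> real n < norm x" for n
    using neg by (metis inverse_positive_iff_positive not_le of_nat_0_less_iff zero_less_Suc)
  then obtain y where y: "\<And>n. y n \<in> radial_set g" "\<And>n. \<bar>g (y n) - c\<bar> < inverse (real (Suc n))"
    "\<And>n. real n < norm (y n)" by metis
  have "filterlim (\<lambda>n. norm (y n)) at_top sequentially"
    by (rule filterlim_at_top_mono[OF filterlim_real_sequentially])
      (auto intro!: always_eventually less_imp_le y(3))
  moreover have "(\<lambda>n. g (y n)) \<longlonglongrightarrow> c"
    unfolding tendsto_iff dist_real_def
  proof (intro allI impI)
    fix e :: real assume "0 < e"
    then have "\<forall>\<^sub>F n in sequentially. inverse (real (Suc n)) < e"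
      by (rule order_tendstoD(2)[OF LIMSEQ_inverse_real_of_nat])
    then show "\<forall>\<^sub>F n in sequentially. \<bar>g (y n) - c\<bar> < e"
      by eventually_elim (rule less_trans[OF y(2)])
  qed
  ultimately have "c \<in> asymp_values g" using y(1) by (auto simp: asymp_values_def)
  then show False using assms by simp
qed

text \<open>The projection \<open>w = \<bar>x\<bar>\<^sup>2 grad g - (grad g \<bullet> x) x\<close> of the gradient is tangent to the spheres, and
  \<open>w \<bullet> grad g\<close> is the Gram determinant of \<open>grad g\<close> and \<open>x\<close>, which vanishes only on the radial set and
  at the origin. Near these points a multiple of \<open>grad g\<close> is added; its coefficient \<open>\<rho>\<close> vanishes for
  \<open>\<bar>x\<bar>\<^sup>2 \<ge> r (g x)\<close>, where \<open>r\<close> majorizes \<open>\<bar>x\<bar>\<^sup>2\<close> on the radial set.\<close>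

lemma level_field_exists:
  fixes g :: "'a::euclidean_space \<Rightarrow> real"
  assumes g: "smooth_on UNIV g" and U: "open U" "is_interval U"
    and crit: "U \<inter> crit_values g = {}" and asymp: "U \<inter> asymp_values g = {}"
  obtains V where "level_field g U V"
proof -
  \<comment> \<open>inserting \<open>0\<close> keeps the supremum meaningful on levels without radial points\<close>
  define S where "S = (\<lambda>c. insert 0 ((\<lambda>x. (norm x)^2) ` (radial_set g \<inter> g -` {c})))"
  have loc: "\<exists>N B. open N \<and> c \<in> N \<and> (\<forall>c'\<in>N. \<forall>s\<in>S c'. s \<le> B)" if cU: "c \<in> U" for c
  proof -
    obtain d B where d: "0 < d" "\<And>x. x \<in> radial_set g \<Longrightarrow> \<bar>g x - c\<bar> < d \<Longrightarrow> norm x \<le> B"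
      using radial_set_locally_bounded[of c g] asymp cU by blast
    have "s \<le> B^2" if "c' \<in> ball c d" "s \<in> S c'" for c' s
      using that d(2) by (force simp: S_def dist_real_def abs_minus_commute intro: power_mono)
    then show ?thesis using d(1) by (metis centre_in_ball open_ball)
  qed
  have "\<exists>N B. open N \<and> c \<in> N \<and> (\<forall>c'\<in>N \<inter> U. Sup (S c') \<le> B)" if cU: "c \<in> U" for c
  proof -
    obtain N B where N: "open N" "c \<in> N" "\<forall>c'\<in>N. \<forall>s\<in>S c'. s \<le> B" using loc[OF cU] by metis
    have "Sup (S c') \<le> B" if "c' \<in> N" for c'
      by (rule cSup_least) (use N that in \<open>auto simp: S_def\<close>)
    then show ?thesis using N by blast
  qed
  then obtain r where r: "smooth_on U r" "\<And>c. c \<in> U \<Longrightarrow> Sup (S c) < r c" "\<And>c. c \<in> U \<Longrightarrow> 0 < r c"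
    using smooth_majorant[OF U(1), of "\<lambda>c. Sup (S c)"] by blast
  have rad: "(norm x)^2 < r (g x)" if "x \<in> radial_set g" "g x \<in> U" for x
  proof -
    have "bdd_above (S (g x))" using loc[OF that(2)] by (meson bdd_above.I)
    then have "(norm x)^2 \<le> Sup (S (g x))" using that by (intro cSup_upper) (auto simp: S_def)
    then show ?thesis using r(2)[OF that(2)] by simp
  qed
  define G where "G = grad g"
  define w where "w = (\<lambda>x. (x \<bullet> x) *\<^sub>R G x - (G x \<bullet> x) *\<^sub>R x)"
  define \<rho> where "\<rho> = (\<lambda>x. flat_exp 0 (r (g x) - x \<bullet> x))"
  define V where "V = (\<lambda>x. inverse (w x \<bullet> G x + \<rho> x * (G x \<bullet> G x)) *\<^sub>R (w x + \<rho> x *\<^sub>R G x))"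
  have G: "smooth_on UNIV G" "\<And>x v. frechet_derivative g (at x) v = G x \<bullet> v"
    unfolding G_def using smooth_gradient[OF g] by auto
  have oU: "open (g -` U)"
    using U(1) smooth_on_imp_continuous_on[OF g] continuous_on_open_vimage[of UNIV g] by simp
  have \<rho>_nonneg: "0 \<le> \<rho> x" for x by (simp add: \<rho>_def flat_exp_nonneg)
  have gram: "w x \<bullet> G x = (x \<bullet> x) * (G x \<bullet> G x) - (x \<bullet> G x)^2" for x
    by (simp add: w_def inner_diff_left inner_commute[of x "G x"] power2_eq_square)
  have wG: "0 \<le> w x \<bullet> G x" for x
    unfolding gram using Cauchy_Schwarz_ineq[of x "G x"] by simp
  have den: "0 < w x \<bullet> G x + \<rho> x * (G x \<bullet> G x)" if x: "g x \<in> U" for x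
  proof -
    have "G x \<noteq> 0" using crit x by (auto simp: crit_values_def G_def)
    then have GG: "0 < G x \<bullet> G x" by simp
    show ?thesis
    proof (cases "w x \<bullet> G x = 0")
      case True
      have "x \<bullet> x < r (g x)"
      proof (cases "x = 0")
        case True
        then show ?thesis using r(3)[OF x] by simp
      next
        case False
        have "w x = 0"
        proof -
          have "w x \<bullet> w x = (x \<bullet> x) * (w x \<bullet> G x)"
            by (simp add: w_def inner_diff_left inner_diff_right inner_commute algebra_simps)
          then show ?thesis using True by simp
        qed
        then have "inverse (x \<bullet> x) *\<^sub>R (x \<bullet> x) *\<^sub>R G x = inverse (x \<bullet> x) *\<^sub>R (G x \<bullet> x) *\<^sub>R x"
          by (simp add: w_def)
        then have "G x = (inverse (x \<bullet> x) * (G x \<bullet> x)) *\<^sub>R x" using False by simp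
        then have "x \<in> radial_set g" unfolding radial_set_def G_def by blast
        then show ?thesis using rad x by (simp add: dot_square_norm)
      qed
      then have "0 < \<rho> x" by (simp add: \<rho>_def flat_exp_pos_iff)
      then show ?thesis using True GG by simp
    next
      case False
      then show ?thesis using wG[of x] \<rho>_nonneg[of x] GG by (intro add_pos_nonneg) auto
    qed
  qed
  have G': "smooth_on (g -` U) G" by (rule smooth_on_subset[OF G(1)]) simp
  have g': "smooth_on (g -` U) g" by (rule smooth_on_subset[OF g]) simp
  have \<rho>': "smooth_on (g -` U) \<rho>"
    unfolding \<rho>_def
    by (rule smooth_on_compose[OF oU open_UNIV smooth_on_flat_exp])
      (auto intro!: smooth_intros[OF oU] smooth_on_compose[OF oU U(1) r(1) g'])
  have w': "smooth_on (g -` U) w" unfolding w_def by (intro smooth_intros[OF oU] G')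
  have "level_field g U V"
  proof
    show "smooth_on (g -` U) V" unfolding V_def
      using den by (intro smooth_intros[OF oU] G' w' \<rho>') (auto simp: less_imp_neq[symmetric])
    show "frechet_derivative g (at x) (V x) = 1" if "g x \<in> U" for x
      using den[OF that, THEN less_imp_neq]
      by (simp add: G V_def inner_add_right inner_commute[of "G x" "w x"])
    fix J assume J: "compact J" "J \<subseteq> U"
    have "bounded (r ` J)"
      using smooth_on_imp_continuous_on[OF r(1)] J
      by (intro compact_imp_bounded compact_continuous_image) (auto intro: continuous_on_subset)
    then obtain B where B: "\<And>c. c \<in> J \<Longrightarrow> \<bar>r c\<bar> \<le> B" by (auto simp: bounded_iff)
    show "\<exists>R. \<forall>x. g x \<in> J \<and> R < norm x \<longrightarrow> V x \<bullet> x = 0"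
    proof (intro exI allI impI)
      fix x assume x: "g x \<in> J \<and> \<bar>B\<bar> + 1 < norm x"
      have "r (g x) \<le> B" using B[of "g x"] x by auto
      also have "\<dots> \<le> norm x * 1" using x by auto
      also have "\<dots> \<le> norm x * norm x" using x by (intro mult_left_mono) auto
      finally have "\<rho> x = 0" by (simp add: \<rho>_def flat_exp_def dot_square_norm power2_eq_square)
      moreover have "w x \<bullet> x = 0" by (simp add: w_def inner_diff_left)
      ultimately show "V x \<bullet> x = 0" by (simp add: V_def)
    qed
  qed (use g U in auto)
  then show thesis by (rule that)
qed

section \<open>Level sets as manifolds\<close>

text \<open>A chart of the ambient space in which \<open>g\<close> is, up to a constant, the coordinate along \<open>e\<close>.
  Its restriction to the level set is a chart with values in the orthogonal complement of \<open>e\<close>.\<close>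

definition slice_chart ::
  "('a::euclidean_space \<Rightarrow> real) \<Rightarrow> real \<Rightarrow> 'a \<Rightarrow> 'a set \<Rightarrow> ('a \<Rightarrow> 'a) \<Rightarrow> bool" where
  "slice_chart g c e W G \<longleftrightarrow> open W \<and> inj_on G W \<and> open (G ` W) \<and>
     smooth_on W G \<and> smooth_on (G ` W) (inv_into W G) \<and> (\<forall>x\<in>W. G x \<bullet> e = g x - c)"

text \<open>Let \<open>u\<close> be the unit vector along \<open>grad g p\<close>, turned into \<open>e\<close> by an orthogonal map \<open>T\<close>, and let \<open>G\<close>
  replace the \<open>e\<close>-coordinate of \<open>T x\<close> by \<open>g x - c\<close>. Two points with the same image lie on a line
  parallel to \<open>u\<close> and have the same value of \<open>g\<close>; as \<open>g\<close> is strictly monotone along such lines near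
  \<open>p\<close>, the map \<open>G\<close> is injective there, and open by invariance of domain. The derivative of the
  inverse \<open>\<zeta>\<close> is an explicit smooth expression \<open>H\<close> in \<open>\<zeta>\<close>, so the differentiability of \<open>\<zeta>\<close> bootstraps.\<close>

lemma slice_chart_exists:
  fixes g :: "real ^ 'n \<Rightarrow> real"
  assumes g: "smooth_on UNIV g" and p: "grad g p \<noteq> 0" and e: "norm e = 1"
  obtains W G where "slice_chart g c e W G" "p \<in> W"
proof -
  define u where "u = grad g p /\<^sub>R norm (grad g p)"
  have gs: "smooth_on UNIV (grad g)" and Dg: "\<And>x v. frechet_derivative g (at x) v = grad g x \<bullet> v"
    using smooth_gradient[OF g] by auto
  have gd: "(g has_derivative (\<lambda>v. grad g x \<bullet> v)) (at x)" for x
    using smooth_on_has_derivative[OF g UNIV_I, of x] by (simp add: Dg[abs_def])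
  obtain T where T: "orthogonal_transformation T" "T u = e"
    using orthogonal_transformation_exists[of u e] p e by (auto simp: u_def)
  have linT: "linear T" and injT: "inj T" and bijT: "bij T"
    using T(1) orthogonal_transformation_linear orthogonal_transformation_inj orthogonal_transformation_bij by blast+
  define S where "S = inv T"
  have linS: "linear S"
    using orthogonal_transformation_inv[OF T(1)] orthogonal_transformation_linear by (auto simp: S_def)
  have ST: "S (T x) = x" for x using injT by (simp add: S_def)
  have ee: "e \<bullet> e = 1" using e by (simp add: dot_square_norm)
  note bT = linear_conv_bounded_linear[THEN iffD1, OF linT] and bS = linear_conv_bounded_linear[THEN iffD1, OF linS]
  define G where "G = (\<lambda>x. T x - (T x \<bullet> e) *\<^sub>R e + (g x - c) *\<^sub>R e)"
  define P where "P = {x. 0 < grad g x \<bullet> u}"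
  have "open P"
    unfolding P_def using smooth_on_imp_continuous_on[OF gs]
    by (intro open_Collect_less continuous_intros) auto
  moreover have "p \<in> P" using p by (simp add: P_def u_def dot_square_norm power2_eq_square)
  ultimately obtain r where r: "0 < r" "ball p r \<subseteq> P" using open_contains_ball by blast
  define W where "W = ball p r"
  have Ge: "G x \<bullet> e = g x - c" for x by (simp add: G_def inner_add_left inner_diff_left ee)
  have smoothG: "smooth_on S G" for S
  proof (rule smooth_on_subset[of UNIV])
    show "smooth_on UNIV G" unfolding G_def
      by (intro smooth_intros[OF open_UNIV] smooth_on_bounded_linear bT g)
  qed simp
  have inj: "inj_on G W"
  proof (rule inj_onI)
    fix x x' assume x: "x \<in> W" "x' \<in> W" and eq: "G x = G x'"
    then have gx: "g x = g x'" using Ge by (metis diff_add_cancel)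
    define k where "k = (T x - T x') \<bullet> e"
    have "T x - T x' = k *\<^sub>R e"
      using eq gx by (simp add: G_def k_def inner_diff_left algebra_simps)
    then have "T (x - x') = T (k *\<^sub>R u)" using T(2) by (simp add: linear_diff[OF linT] linear_scale[OF linT])
    then have xk: "x - x' = k *\<^sub>R u" using injT by (simp add: inj_eq)
    have D: "((\<lambda>s. g (x' + s *\<^sub>R (x - x'))) has_derivative (\<lambda>h. grad g (x' + s *\<^sub>R (x - x')) \<bullet> (h *\<^sub>R (x - x')))) (at s within {0..1})" for s
      by (rule has_derivative_compose[OF _ gd]) (auto intro!: derivative_eq_intros)
    obtain s where s: "s \<in> {0<..<1}" and
      "g (x' + 1 *\<^sub>R (x - x')) - g (x' + 0 *\<^sub>R (x - x')) = grad g (x' + s *\<^sub>R (x - x')) \<bullet> ((1 - 0) *\<^sub>R (x - x'))"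
      using mvt_simple[of 0 1 "\<lambda>s. g (x' + s *\<^sub>R (x - x'))", OF _ D] by auto
    then have "k * (grad g (x' + s *\<^sub>R (x - x')) \<bullet> u) = 0"
      using gx xk by (simp add: algebra_simps)
    moreover have "x' + s *\<^sub>R (x - x') \<in> closed_segment x' x"
      using s by (auto simp: in_segment algebra_simps intro!: exI[of _ s])
    then have "x' + s *\<^sub>R (x - x') \<in> P"
      using x r closed_segment_subset[of x' W x] by (auto simp: W_def)
    ultimately have "k = 0" by (simp add: P_def)
    then show "x = x'" using xk by simp
  qed
  define \<zeta> where "\<zeta> = inv_into W G"
  have oW: "open W" by (simp add: W_def)
  have contG: "continuous_on W G" by (rule smooth_on_imp_continuous_on[OF smoothG])
  have oGW: "open (G ` W)" by (rule invariance_of_domain[OF contG oW inj])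
  have \<zeta>W: "\<zeta> y \<in> W" and G\<zeta>: "G (\<zeta> y) = y" if "y \<in> G ` W" for y
    using that by (simp_all add: \<zeta>_def inv_into_into f_inv_into_f)
  have cont\<zeta>: "continuous_on (G ` W) \<zeta>"
    by (rule continuous_on_inverse_open[OF oW contG]) (auto simp: \<zeta>_def inv_into_f_f[OF inj])
  \<comment> \<open>\<open>H v x\<close> solves \<open>DG x h = v\<close> for \<open>h\<close>: the part of \<open>v\<close> orthogonal to \<open>e\<close> determines \<open>h\<close> up to a
    multiple of \<open>u\<close>, and this multiple is fixed by \<open>grad g x \<bullet> h = v \<bullet> e\<close>\<close>
  define q where "q = (\<lambda>v. S (v - (v \<bullet> e) *\<^sub>R e))"
  define H where "H = (\<lambda>v x. q v + ((v \<bullet> e - grad g x \<bullet> q v) * inverse (grad g x \<bullet> u)) *\<^sub>R u)"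
  have \<zeta>': "(\<zeta> has_derivative (\<lambda>v. H v (\<zeta> y))) (at y)" if y: "y \<in> G ` W" for y
  proof (rule has_derivative_inverse_basic)
    define x where "x = \<zeta> y"
    have gu: "grad g x \<bullet> u \<noteq> 0" using \<zeta>W[OF y] r by (force simp: W_def P_def x_def)
    show "(G has_derivative (\<lambda>h. T h - (T h \<bullet> e) *\<^sub>R e + (grad g (\<zeta> y) \<bullet> h) *\<^sub>R e)) (at (\<zeta> y))"
      unfolding G_def by (rule derivative_eq_intros bounded_linear.has_derivative[OF bT] gd refl)+ simp
    have "bounded_linear q"
      unfolding q_def by (intro bounded_linear_compose[OF bS] bounded_linear_sub bounded_linear_ident
          bounded_linear_scaleR_const bounded_linear_inner_left)
    then show "bounded_linear (\<lambda>v. H v (\<zeta> y))"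
      unfolding H_def
      by (intro bounded_linear_add bounded_linear_scaleR_const bounded_linear_mult_const bounded_linear_sub
          bounded_linear_inner_left bounded_linear_compose[OF bounded_linear_inner_right])
    show "(\<lambda>v. H v (\<zeta> y)) \<circ> (\<lambda>h. T h - (T h \<bullet> e) *\<^sub>R e + (grad g (\<zeta> y) \<bullet> h) *\<^sub>R e) = id"
    proof
      fix h
      define v where "v = T h - (T h \<bullet> e) *\<^sub>R e + (grad g x \<bullet> h) *\<^sub>R e"
      have ve: "v \<bullet> e = grad g x \<bullet> h" by (simp add: v_def inner_add_left inner_diff_left ee)
      have "v - (v \<bullet> e) *\<^sub>R e = T (h - (T h \<bullet> e) *\<^sub>R u)"
        unfolding ve by (simp add: v_def linear_diff[OF linT] linear_scale[OF linT] T(2))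
      then have "q v = h - (T h \<bullet> e) *\<^sub>R u" by (simp add: q_def ST)
      then have "H v x = h" using gu by (simp add: H_def ve inner_diff_right)
      then show "((\<lambda>v. H v (\<zeta> y)) \<circ> (\<lambda>h. T h - (T h \<bullet> e) *\<^sub>R e + (grad g (\<zeta> y) \<bullet> h) *\<^sub>R e)) h = id h"
        by (simp add: v_def x_def)
    qed
    show "continuous (at y) \<zeta>" using cont\<zeta> oGW y continuous_on_eq_continuous_at by blast
  qed (use oGW y G\<zeta> in auto)
  have Hs: "smooth_on W (H v)" for v
    unfolding H_def using r smooth_on_subset[OF gs]
    by (intro smooth_intros[OF oW]) (auto simp: W_def P_def)
  have "Ck_on k (G ` W) \<zeta>" for k
  proof (induction k)
    case 0
    then show ?case using cont\<zeta> by simp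
  next
    case (Suc k)
    show ?case
      by (rule Ck_on_SucI[OF oGW \<zeta>'])
        (auto intro!: Ck_on_compose[OF oGW oW \<zeta>W smooth_on_imp_Ck_on[OF Hs] Suc])
  qed
  then have "slice_chart g c e W G"
    using oW inj oGW smoothG Ge by (simp add: slice_chart_def smooth_on_def \<zeta>_def)
  then show thesis using that r by (simp add: W_def)
qed

definition level_manifold ::
  "('a::euclidean_space \<Rightarrow> real) \<Rightarrow> real \<Rightarrow> 'a \<Rightarrow> ('a, 'a) smooth_space" where
  "level_manifold g c e = \<lparr>top_of = top_of_set (g -` {c}), model = {x. x \<bullet> e = 0},
     atlas = {(g -` {c} \<inter> W, G) | W G. slice_chart g c e W G}\<rparr>"

lemma slice_chart_inverse:
  assumes "slice_chart g c e W G" "x \<in> W" "g x = c"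
  shows "inv_into W G (G x) = x" "inv_into (g -` {c} \<inter> W) G (G x) = x"
  using assms by (auto simp: slice_chart_def intro!: inv_into_f_f inj_on_subset[of G W])

lemma second_countable_euclidean:
  "second_countable (top_of_set (S :: 'a::second_countable_topology set))"
proof (rule second_countable_subtopology)
  obtain B :: "'a set set" where B: "countable B" "topological_basis B"
    using ex_countable_basis by blast
  show "second_countable (euclidean :: 'a topology)"
    unfolding second_countable_def
  proof (intro exI[of _ B] conjI ballI allI impI)
    show "openin euclidean V" if "V \<in> B" for V
      using topological_basis_open[OF B(2) that] by simp
    fix T and x :: 'a assume "openin euclidean T \<and> x \<in> T"
    then have "open T" "x \<in> T" by simp_all
    then obtain V where "V \<in> B" "x \<in> V" "V \<subseteq> T" by (rule topological_basisE[OF B(2)])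
    then show "\<exists>V\<in>B. x \<in> V \<and> V \<subseteq> T" by blast
  qed (rule B(1))
qed

text \<open>Transition maps are restrictions of transition maps between ambient charts, which are smooth on
  open sets.\<close>

lemma smooth_manifold_level_manifold:
  assumes cover: "\<And>x. g x = c \<Longrightarrow> \<exists>W G. slice_chart g c e W G \<and> x \<in> W"
  shows "smooth_manifold (level_manifold g c e)"
  unfolding smooth_manifold_def
proof (intro conjI)
  let ?F = "g -` {c}"
  show "Hausdorff_space (top_of (level_manifold g c e))"
    by (simp add: level_manifold_def Hausdorff_space_subtopology)
  show "second_countable (top_of (level_manifold g c e))"
    by (simp add: level_manifold_def second_countable_euclidean)
  show "subspace (model (level_manifold g c e))"
    by (simp add: level_manifold_def subspace_hyperplane2)
  show "(\<Union>(V, \<phi>)\<in>atlas (level_manifold g c e). V) = topspace (top_of (level_manifold g c e))"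
  proof
    show "topspace (top_of (level_manifold g c e)) \<subseteq> (\<Union>(V, \<phi>)\<in>atlas (level_manifold g c e). V)"
    proof
      fix x assume "x \<in> topspace (top_of (level_manifold g c e))"
      then have x: "g x = c" by (simp add: level_manifold_def)
      then obtain W G where "slice_chart g c e W G" "x \<in> W" using cover by blast
      then have "(?F \<inter> W, G) \<in> atlas (level_manifold g c e)" "x \<in> ?F \<inter> W"
        using x by (auto simp: level_manifold_def)
      then show "x \<in> (\<Union>(V, \<phi>)\<in>atlas (level_manifold g c e). V)" by blast
    qed
  qed (auto simp: level_manifold_def)
  show "\<forall>(V, \<phi>)\<in>atlas (level_manifold g c e). openin (top_of (level_manifold g c e)) V \<and>
        openin (top_of_set (model (level_manifold g c e))) (\<phi> ` V) \<and>
        homeomorphic_map (subtopology (top_of (level_manifold g c e)) V) (top_of_set (\<phi> ` V)) \<phi>"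
  proof clarify
    fix V G assume "(V, G) \<in> atlas (level_manifold g c e)"
    then obtain W where V: "V = ?F \<inter> W" and sc: "slice_chart g c e W G"
      by (auto simp: level_manifold_def)
    have sc': "open W" "open (G ` W)" "continuous_on W G" "continuous_on (G ` W) (inv_into W G)"
      "\<And>x. x \<in> W \<Longrightarrow> G x \<bullet> e = g x - c"
      using sc smooth_on_imp_continuous_on by (auto simp: slice_chart_def)
    have "openin (top_of_set ?F) V" using sc' V by (simp add: openin_open_Int)
    moreover have "G ` V = {x. x \<bullet> e = 0} \<inter> G ` W" using sc'(5) by (force simp: V)
    then have "openin (top_of_set {x. x \<bullet> e = 0}) (G ` V)" using sc'(2) by (simp add: openin_open_Int)
    moreover have "homeomorphic_map (top_of_set V) (top_of_set (G ` V)) G"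
      unfolding homeomorphic_map_maps homeomorphic_maps_def
    proof (intro exI conjI ballI)
      show "continuous_map (top_of_set V) (top_of_set (G ` V)) G"
        using continuous_on_subset[OF sc'(3)] by (auto simp: V)
      show "continuous_map (top_of_set (G ` V)) (top_of_set V) (inv_into W G)"
        using continuous_on_subset[OF sc'(4), of "G ` V"] slice_chart_inverse(1)[OF sc] by (auto simp: V)
    qed (auto simp: V slice_chart_inverse(1)[OF sc])
    ultimately show "openin (top_of (level_manifold g c e)) V \<and>
        openin (top_of_set (model (level_manifold g c e))) (G ` V) \<and>
        homeomorphic_map (subtopology (top_of (level_manifold g c e)) V) (top_of_set (G ` V)) G"
      by (simp add: level_manifold_def subtopology_subtopology V Int_assoc[symmetric])
  qed
  show "\<forall>(V, \<phi>)\<in>atlas (level_manifold g c e). \<forall>(W, \<psi>)\<in>atlas (level_manifold g c e).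
        loc_smooth_on (\<phi> ` (V \<inter> W)) (\<psi> \<circ> inv_into V \<phi>)"
  proof clarify
    fix V G V' G'
    assume "(V, G) \<in> atlas (level_manifold g c e)" "(V', G') \<in> atlas (level_manifold g c e)"
    then obtain W W' where V: "V = ?F \<inter> W" "V' = ?F \<inter> W'"
      and sc: "slice_chart g c e W G" and sc': "slice_chart g c e W' G'"
      by (auto simp: level_manifold_def)
    define O1 where "O1 = G ` W \<inter> inv_into W G -` W'"
    have *: "open (G ` W)" "smooth_on (G ` W) (inv_into W G)" "open W'" "smooth_on W' G'"
      using sc sc' by (auto simp: slice_chart_def)
    have O1: "open O1"
      unfolding O1_def by (rule continuous_open_preimage[OF smooth_on_imp_continuous_on[OF *(2)] *(1,3)])
    have "smooth_on O1 (\<lambda>z. G' (inv_into W G z))"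
      by (rule smooth_on_compose[OF O1 *(3,4) smooth_on_subset[OF *(2)]]) (auto simp: O1_def)
    moreover have "G ` (V \<inter> V') \<subseteq> O1"
      using slice_chart_inverse(1)[OF sc] by (auto simp: V O1_def)
    moreover have "inv_into W G z = inv_into V G z" if "z \<in> G ` (V \<inter> V')" for z
      using that slice_chart_inverse[OF sc] by (auto simp: V)
    ultimately show "loc_smooth_on (G ` (V \<inter> V')) (G' \<circ> inv_into V G)"
      unfolding loc_smooth_on_def using O1
      by (intro ballI exI[of _ O1] exI[of _ "\<lambda>z. G' (inv_into W G z)"]) auto
  qed
qed

section \<open>The trivialization\<close>

lemma smooth_trivial_fibration_empty: "smooth_trivial_fibration (g :: 'a::euclidean_space \<Rightarrow> real) {}"
proof -
  define F :: "('a, 'a) smooth_space" where "F = \<lparr>top_of = top_of_set {}, model = UNIV, atlas = {}\<rparr>"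
  have "smooth_manifold F"
    using second_countable_euclidean[of "{} :: 'a set"]
    by (simp add: smooth_manifold_def F_def Hausdorff_space_subtopology second_countable_euclidean)
  moreover have "diffeomorphism (euclidean_open (g -` {})) (prod_space F (euclidean_open {})) (\<lambda>x. (x, g x))"
    by (auto simp: diffeomorphism_def smooth_map_def euclidean_open_def prod_space_def F_def loc_smooth_on_def
        intro!: exI[of _ fst])
  ultimately show ?thesis unfolding smooth_trivial_fibration_def by blast
qed

context level_field
begin

lemma smooth_trivial_fibration_over:
  assumes c: "c \<in> U"
    and cover: "\<And>x. g x = c \<Longrightarrow> \<exists>W G. slice_chart g c e W G \<and> x \<in> W"
  shows "smooth_trivial_fibration g U"
proof -
  define F where "F = level_manifold g c e"
  define \<Phi> where "\<Phi> = (\<lambda>x. (transport (c, x), g x))"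
  define \<Psi> where "\<Psi> = (\<lambda>(y, t). transport (t, y))"
  have tc: "smooth_on (g -` U) (\<lambda>x. transport (c, x))"
    by (rule smooth_on_compose[OF open_domain open_Times[OF U(1) open_domain] transport_smooth])
      (use c in \<open>auto intro!: smooth_intros[OF open_domain]\<close>)
  have gs: "smooth_on S g" for S using g smooth_on_subset by blast
  have "smooth_map (euclidean_open (g -` U)) (prod_space F (euclidean_open U)) \<Phi>"
    unfolding smooth_map_def
  proof
    show "continuous_map (top_of (euclidean_open (g -` U))) (top_of (prod_space F (euclidean_open U))) \<Phi>"
      using smooth_on_imp_continuous_on[OF tc] g_continuous transport_props(1) c
      by (auto simp: euclidean_open_def prod_space_def F_def level_manifold_def \<Phi>_def intro!: continuous_intros)
    show "\<forall>(V, \<phi>)\<in>atlas (euclidean_open (g -` U)). \<forall>(W, \<psi>)\<in>atlas (prod_space F (euclidean_open U)).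
        loc_smooth_on (\<phi> ` {x \<in> V. \<Phi> x \<in> W}) (\<psi> \<circ> \<Phi> \<circ> inv_into V \<phi>)"
    proof clarify
      fix V \<phi> W \<psi>
      assume "(V, \<phi>) \<in> atlas (euclidean_open (g -` U))" "(W, \<psi>) \<in> atlas (prod_space F (euclidean_open U))"
      then obtain W1 G where V: "V = g -` U" "\<phi> = id" and W: "W = (g -` {c} \<inter> W1) \<times> U" "\<psi> = map_prod G id"
        and sc: "slice_chart g c e W1 G"
        by (auto simp: euclidean_open_def prod_space_def F_def level_manifold_def)
      have W1: "open W1" "smooth_on W1 G" using sc by (auto simp: slice_chart_def)
      define N where "N = g -` U \<inter> (\<lambda>x. transport (c, x)) -` W1"
      have N: "open N" unfolding N_def
        by (rule continuous_open_preimage[OF smooth_on_imp_continuous_on[OF tc] open_domain W1(1)])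
      have "smooth_on N (\<lambda>x. (G (transport (c, x)), g x))"
        by (intro smooth_on_Pair[OF N] smooth_on_compose[OF N W1] gs)
          (auto simp: N_def intro: smooth_on_subset[OF tc])
      then show "loc_smooth_on (\<phi> ` {x \<in> V. \<Phi> x \<in> W}) (\<psi> \<circ> \<Phi> \<circ> inv_into V \<phi>)"
        unfolding loc_smooth_on_def using N
        by (intro ballI exI[of _ N] exI[of _ "\<lambda>x. (G (transport (c, x)), g x)"])
          (auto simp: V W N_def \<Phi>_def)
    qed
  qed
  moreover have "smooth_map (prod_space F (euclidean_open U)) (euclidean_open (g -` U)) \<Psi>"
    unfolding smooth_map_def
  proof
    have "continuous_on (g -` {c} \<times> U) (\<lambda>yt. transport (snd yt, fst yt))"
      using c by (intro continuous_on_compose2[OF smooth_on_imp_continuous_on[OF transport_smooth]] continuous_intros) auto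
    then show "continuous_map (top_of (prod_space F (euclidean_open U))) (top_of (euclidean_open (g -` U))) \<Psi>"
      using transport_props(1) c
      by (auto simp: euclidean_open_def prod_space_def F_def level_manifold_def \<Psi>_def case_prod_beta')
    show "\<forall>(V, \<phi>)\<in>atlas (prod_space F (euclidean_open U)). \<forall>(W, \<psi>)\<in>atlas (euclidean_open (g -` U)).
        loc_smooth_on (\<phi> ` {x \<in> V. \<Psi> x \<in> W}) (\<psi> \<circ> \<Psi> \<circ> inv_into V \<phi>)"
    proof clarify
      fix V \<phi> W \<psi>
      assume "(V, \<phi>) \<in> atlas (prod_space F (euclidean_open U))" "(W, \<psi>) \<in> atlas (euclidean_open (g -` U))"
      then obtain W1 G where W: "W = g -` U" "\<psi> = id" and V: "V = (g -` {c} \<inter> W1) \<times> U" "\<phi> = map_prod G id"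
        and sc: "slice_chart g c e W1 G"
        by (auto simp: euclidean_open_def prod_space_def F_def level_manifold_def)
      have W1: "open W1" "open (G ` W1)" "smooth_on (G ` W1) (inv_into W1 G)" "inj_on G W1"
        using sc by (auto simp: slice_chart_def)
      define N where "N = (G ` W1 \<inter> inv_into W1 G -` (g -` U)) \<times> U"
      have N: "open N" unfolding N_def
        by (intro open_Times U continuous_open_preimage[OF smooth_on_imp_continuous_on[OF W1(3)] W1(2) open_domain])
      define h where "h = (\<lambda>zt. transport (snd zt, inv_into W1 G (fst zt)))"
      have "smooth_on N (\<lambda>zt. inv_into W1 G (fst zt))"
        by (rule smooth_on_compose[OF N W1(2,3) smooth_on_fst[OF N smooth_on_ident]]) (auto simp: N_def)
      then have "smooth_on N h" unfolding h_def
        by (intro smooth_on_compose[OF N open_Times[OF U(1) open_domain] transport_smooth] smooth_on_Pair[OF N]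
            smooth_on_snd[OF N smooth_on_ident]) (auto simp: N_def)
      moreover have "map_prod G id z \<in> N \<and> h (map_prod G id z) = \<Psi> (inv_into V \<phi> (map_prod G id z))"
        if "z \<in> V" for z
      proof -
        have "inj_on \<phi> V" unfolding V using W1(4) by (auto simp: inj_on_def)
        then have "inv_into V \<phi> (\<phi> z) = z" using that by (rule inv_into_f_f)
        then show ?thesis
          using that c slice_chart_inverse(1)[OF sc] by (auto simp: V h_def \<Psi>_def N_def)
      qed
      ultimately show "loc_smooth_on (\<phi> ` {x \<in> V. \<Psi> x \<in> W}) (\<psi> \<circ> \<Psi> \<circ> inv_into V \<phi>)"
        unfolding loc_smooth_on_def using N
        by (intro ballI exI[of _ N] exI[of _ h]) (auto simp: V(2) W)
    qed
  qed
  moreover have "\<Psi> (\<Phi> x) = x" if "g x \<in> U" for x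
    using transport_props[OF that that c] by (simp add: \<Phi>_def \<Psi>_def)
  moreover have "\<Phi> (\<Psi> yt) = yt" if "fst yt \<in> g -` {c}" "snd yt \<in> U" for yt
    using transport_props[of "fst yt" c "snd yt"] that c by (auto simp: \<Phi>_def \<Psi>_def case_prod_beta)
  ultimately have "diffeomorphism (euclidean_open (g -` U)) (prod_space F (euclidean_open U)) \<Phi>"
    unfolding diffeomorphism_def
    by (intro conjI exI[of _ \<Psi>]) (auto simp: euclidean_open_def prod_space_def F_def level_manifold_def)
  moreover have "smooth_manifold F"
    unfolding F_def by (rule smooth_manifold_level_manifold[OF cover])
  moreover have "snd (\<Phi> x) = g x" for x by (simp add: \<Phi>_def)
  ultimately show ?thesis unfolding smooth_trivial_fibration_def by blast
qed

end

theorem proposition1p4: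
  fixes g :: "real ^ 'n \<Rightarrow> real" and U :: "real set"
  assumes "smooth_on UNIV g"
    and "open U" and "is_interval U"
    and "U \<subseteq> range g - (crit_values g \<union> asymp_values g)"
  shows "smooth_trivial_fibration g U"
proof (cases "U = {}")
  case True
  then show ?thesis by (simp add: smooth_trivial_fibration_empty)
next
  case False
  then obtain c where c: "c \<in> U" by blast
  obtain V where "level_field g U V"
    using level_field_exists[of g U] assms by blast
  then interpret level_field g U V .
  define e where "e = axis (undefined :: 'n) (1::real)"
  have "grad g x \<noteq> 0" if "g x = c" for x
    using that c assms(4) by (force simp: crit_values_def)
  then show ?thesis
    using slice_chart_exists[OF assms(1), of _ e c] by (intro smooth_trivial_fibration_over[OF c, of e])
      (metis e_def norm_axis_1)
qed

end
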